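(* Let $0<\Delta\le\infty$. If $\{X(t):0\le t<\Delta\}$ is a real, continuous, zero-mean Gaussian process with $X(0)=0$ and smooth covariance function $E[X(s)X(t)]=r(s,t)$ on $0\le s\le t<\Delta$, then $X$ has stationary increments and the Markov property if and only if $$r(s,t)=s(\theta-\tau t)\qquad(0\le s\le t<\Delta)$$ for some $\theta>0$ and $\tau\le\theta/\Delta$.
   Context: "Smooth" describes a function that is twice continuously differentiable over its entire domain in each of its arguments. $X$ has stationary increments when $E[(X(t+s)-X(s))^2]$ does not vary with $s$ on $0\le s\le s+t<\Delta$ (wide-sense stationarity of increments; since $X$ is zero-mean Gaussian, the increments are then also strictly stationary). When $\Delta=\infty$, $\theta/\Delta$ is read as $0$.
   Formalization: The process is additionally assumed non-degenerate: some two values X(s), X(t) are almost surely linearly independent; without this X(t)=tZ with Z Gaussian is a counterexample, since its covariance st forces θ=0. *)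

theory Defs
  imports "HOL-Probability.Probability"
begin

text \<open>
  One-dimensional normal laws, including the point masses (variance zero): otherwise a
  process with value 0 at time 0 would never be Gaussian.
\<close>
definition gaussian_rv :: "'a measure \<Rightarrow> ('a \<Rightarrow> real) \<Rightarrow> bool" where
  "gaussian_rv M Y \<longleftrightarrow>
     Y \<in> borel_measurable M \<and>
     ((\<exists>m. AE \<omega> in M. Y \<omega> = m) \<or>
      (\<exists>m \<sigma>. 0 < \<sigma> \<and> distributed M lborel Y (normal_density m \<sigma>)))"

definition gaussian_process :: "'a measure \<Rightarrow> real set \<Rightarrow> (real \<Rightarrow> 'a \<Rightarrow> real) \<Rightarrow> bool" where
  "gaussian_process M T X \<longleftrightarrow>
     (\<forall>t\<in>T. X t \<in> borel_measurable M) \<and>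
     (\<forall>I c. finite I \<and> I \<subseteq> T \<longrightarrow> gaussian_rv M (\<lambda>\<omega>. \<Sum>t\<in>I. c t * X t \<omega>))"

text \<open>
  Some two values of the process are linearly independent as random variables, i.e. the process
  is not a deterministic function times one single random variable. Among the centred Gaussian Markov processes with
  stationary increments and smooth covariance that start at 0, this excludes exactly
  \<open>X t = t * Z\<close> with \<open>Z\<close> centred Gaussian, possibly zero: it is Markov with stationary increments,
  but its covariance is \<open>s * (\<theta> - \<tau> * t)\<close> only with \<open>\<theta> = 0\<close>.
\<close>
definition nondegenerate :: "'a measure \<Rightarrow> real set \<Rightarrow> (real \<Rightarrow> 'a \<Rightarrow> real) \<Rightarrow> bool" where
  "nondegenerate M T X \<longleftrightarrow>
     (\<exists>s\<in>T. \<exists>t\<in>T. \<forall>a b. (AE \<omega> in M. a * X s \<omega> + b * X t \<omega> = 0) \<longrightarrow> a = 0 \<and> b = 0)"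

text \<open>
  Twice continuously differentiable relative to \<open>S\<close>; derivatives are one-sided at those endpoints
  of an interval that belong to it.
\<close>
definition C2_on :: "real set \<Rightarrow> (real \<Rightarrow> real) \<Rightarrow> bool" where
  "C2_on S f \<longleftrightarrow>
     (\<exists>f' f''. (\<forall>x\<in>S. (f has_real_derivative f' x) (at x within S) \<and>
                       (f' has_real_derivative f'' x) (at x within S)) \<and>
               continuous_on S f'')"

text \<open>
  A covariance function is only required to be smooth on the half \<open>s \<le> t\<close> of the square (the
  covariance \<open>min s t\<close> of Brownian motion has a kink on the diagonal).
\<close>
definition smooth_covariance :: "real set \<Rightarrow> (real \<Rightarrow> real \<Rightarrow> real) \<Rightarrow> bool" where
  "smooth_covariance T r \<longleftrightarrow>
     (\<forall>t\<in>T. C2_on {s\<in>T. s \<le> t} (\<lambda>s. r s t)) \<and>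
     (\<forall>s\<in>T. C2_on {t\<in>T. s \<le> t} (\<lambda>t. r s t))"

definition stationary_increments :: "'a measure \<Rightarrow> real set \<Rightarrow> (real \<Rightarrow> 'a \<Rightarrow> real) \<Rightarrow> bool" where
  "stationary_increments M T X \<longleftrightarrow>
     (\<forall>t\<ge>0. \<forall>s s'. s \<in> T \<and> s + t \<in> T \<and> s' \<in> T \<and> s' + t \<in> T \<longrightarrow>
        integral\<^sup>L M (\<lambda>\<omega>. (X (t + s) \<omega> - X s \<omega>)\<^sup>2) =
        integral\<^sup>L M (\<lambda>\<omega>. (X (t + s') \<omega> - X s' \<omega>)\<^sup>2))"

definition generated_sigma :: "'a measure \<Rightarrow> (real \<Rightarrow> 'a \<Rightarrow> real) \<Rightarrow> real set \<Rightarrow> 'a measure" where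
  "generated_sigma M X I =
     sigma (space M) {X u -` A \<inter> space M | u A. u \<in> I \<and> A \<in> sets borel}"

text \<open>
  \<open>P(X t \<in> A | X u, u \<le> s) = P(X t \<in> A | X s)\<close> almost surely.
\<close>
definition markov_property :: "'a measure \<Rightarrow> real set \<Rightarrow> (real \<Rightarrow> 'a \<Rightarrow> real) \<Rightarrow> bool" where
  "markov_property M T X \<longleftrightarrow>
     (\<forall>s\<in>T. \<forall>t\<in>T. s \<le> t \<longrightarrow> (\<forall>A\<in>sets borel. AE \<omega> in M.
        real_cond_exp M (generated_sigma M X {u\<in>T. u \<le> s}) (\<lambda>\<omega>. indicator A (X t \<omega>)) \<omega> =
        real_cond_exp M (generated_sigma M X {s}) (\<lambda>\<omega>. indicator A (X t \<omega>)) \<omega>))"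

end

theory Submission
  imports Defs
begin

text \<open>
  For centred Gaussian families, decorrelation is transferred to conditional expectations by
  one-dimensional Fourier uniqueness only: an integrable \<open>h\<close> orthogonal to all
  \<open>cos (a * Z + \<phi>)\<close> is orthogonal to all functions of \<open>Z\<close>, and applying this to one coordinate
  at a time reaches all cylinder sets. Hence the Markov property is equivalent to
  \<open>r u t * r s s = r u s * r s t\<close> for \<open>u \<le> s \<le> t\<close> (with the regression coefficient read as 0 if
  \<open>r s s = 0\<close>).

  Stationary increments give \<open>r s t = (v s + v t - v (t - s)) / 2\<close> with \<open>v t = r t t\<close>. The variance
  has no positive zero unless it vanishes identically, and it is twice differentiable because
  \<open>v x = r u x * r x t / r u t\<close> for \<open>u < x < t\<close>. Differentiating the Markov identity in \<open>u\<close> at 0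
  and in \<open>t\<close> at \<open>s\<close> yields \<open>2 * v'' * v = v'\<^sup>2 - \<theta>\<^sup>2\<close> with \<open>\<theta> = v' 0\<close>; so \<open>(v'\<^sup>2 - \<theta>\<^sup>2) / v\<close> has
  derivative 0 and \<open>v''\<close> is constant.
\<close>

section \<open>Fourier uniqueness and normal laws\<close>

text \<open>Divided by their common total mass \<open>m\<close>, \<open>f\<close> and
  \<open>g\<close> are densities of probability measures. The hypothesis says that \<open>Z\<close>
  has the same characteristic function under both: the phases \<open>0\<close> and
  \<open>- pi/2\<close> supply the real and the imaginary part. Levy's uniqueness theorem then makes
  the two laws of \<open>Z\<close> equal.\<close>

lemma (in prob_space) fourier_uniqueness_nonneg:
  fixes f g Z :: "'a \<Rightarrow> real" and k :: "real \<Rightarrow> real"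
  assumes f: "integrable M f" and g: "integrable M g"
    and f_nonneg: "\<And>x. 0 \<le> f x" and g_nonneg: "\<And>x. 0 \<le> g x"
    and Z [measurable]: "Z \<in> borel_measurable M" and k [measurable]: "k \<in> borel_measurable borel"
    and eq: "\<And>a \<phi>. (\<integral>x. f x * cos (a * Z x + \<phi>) \<partial>M) = (\<integral>x. g x * cos (a * Z x + \<phi>) \<partial>M)"
  shows "(\<integral>x. f x * k (Z x) \<partial>M) = (\<integral>x. g x * k (Z x) \<partial>M)"
proof -
  define m where "m = (\<integral>x. f x \<partial>M)"
  have m_g: "m = (\<integral>x. g x \<partial>M)"
    using eq[of 0 0] by (simp add: m_def)
  have [measurable]: "f \<in> borel_measurable M" "g \<in> borel_measurable M"
    using f g by auto
  consider "m = 0" | "m > 0"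
    using f_nonneg m_def by (metis Bochner_Integration.integral_nonneg less_eq_real_def)
  then show ?thesis
  proof cases
    case 1
    have "AE x in M. f x = 0" "AE x in M. g x = 0"
      using 1 m_g m_def integral_nonneg_eq_0_iff_AE[OF f] integral_nonneg_eq_0_iff_AE[OF g]
        f_nonneg g_nonneg by auto
    then have "AE x in M. f x * k (Z x) = 0" "AE x in M. g x * k (Z x) = 0"
      by auto
    then show ?thesis
      by (simp add: integral_eq_zero_AE)
  next
    case 2
    define P where "P u = distr (density M (\<lambda>x. ennreal (u x / m))) borel Z" for u :: "'a \<Rightarrow> real"
    have P_integral: "integral\<^sup>L (P u) w = (\<integral>x. (u x / m) *\<^sub>R w (Z x) \<partial>M)"
      if "integrable M u" "\<And>x. 0 \<le> u x" "w \<in> borel_measurable borel"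
      for u and w :: "real \<Rightarrow> 'b::{banach, second_countable_topology}"
      using that 2 unfolding P_def
      by (subst integral_distr; simp?) (subst integral_density; simp?)
    have P_real: "real_distribution (P u)"
      if u: "integrable M u" "\<And>x. 0 \<le> u x" "(\<integral>x. u x \<partial>M) = m" for u
    proof -
      have "prob_space (density M (\<lambda>x. ennreal (u x / m)))"
        using u 2 by (intro prob_spaceI) (simp add: emeasure_density nn_integral_eq_integral)
      then show ?thesis
        unfolding P_def using Z by (intro prob_space.real_distribution_distr) auto
    qed
    have P_char: "char (P u) t = Complex ((\<integral>x. u x * cos (t * Z x + 0) \<partial>M) / m)
         ((\<integral>x. u x * cos (t * Z x + (- pi/2)) \<partial>M) / m)"
      if u: "integrable M u" "\<And>x. 0 \<le> u x" for u t
    proof -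
      have [measurable]: "u \<in> borel_measurable M" using u by auto
      have int: "integrable M (\<lambda>x. (u x / m) *\<^sub>R iexp (t * Z x))"
        by (rule Bochner_Integration.integrable_bound[OF u(1)[THEN integrable_divide, of m]])
           (auto simp: norm_mult abs_mult)
      have "char (P u) t = (\<integral>x. (u x / m) *\<^sub>R iexp (t * Z x) \<partial>M)"
        unfolding char_def using u by (subst P_integral) auto
      then show ?thesis
        using integral_Re[OF int] integral_Im[OF int]
        by (intro complex_eqI) (simp_all add: Re_exp Im_exp cos_diff)
    qed
    have "char (P f) = char (P g)"
      unfolding P_char[OF f f_nonneg] P_char[OF g g_nonneg] fun_eq_iff eq by simp
    then have "P f = P g"
      using f g f_nonneg g_nonneg m_g m_def by (intro Levy_uniqueness P_real) auto
    then have "(\<integral>x. (f x / m) *\<^sub>R k (Z x) \<partial>M) = (\<integral>x. (g x / m) *\<^sub>R k (Z x) \<partial>M)"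
      using P_integral[OF f f_nonneg k] P_integral[OF g g_nonneg k] by (metis (no_types, lifting))
    then show ?thesis
      using 2 by simp
  qed
qed

text \<open>The positive and negative parts of \<open>h\<close> have equal cosine integrals, so the
  version for nonnegative weights identifies their integrals against \<open>k (Z x)\<close>.
  Integrability of the product is what lets these integrals be subtracted, also for unbounded
  \<open>k\<close> such as the identity.\<close>

lemma (in prob_space) fourier_uniqueness:
  fixes h Z :: "'a \<Rightarrow> real" and k :: "real \<Rightarrow> real"
  assumes h: "integrable M h"
    and Z [measurable]: "Z \<in> borel_measurable M" and k [measurable]: "k \<in> borel_measurable borel"
    and int: "integrable M (\<lambda>x. h x * k (Z x))"
    and zero: "\<And>a \<phi>. (\<integral>x. h x * cos (a * Z x + \<phi>) \<partial>M) = 0"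
  shows "(\<integral>x. h x * k (Z x) \<partial>M) = 0"
proof -
  define p n where "p x = max (h x) 0" and "n x = max (- h x) 0" for x
  have [measurable]: "h \<in> borel_measurable M" using h by auto
  have h_eq: "h x = p x - n x" for x
    by (auto simp: p_def n_def max_def)
  have p: "integrable M p" and n: "integrable M n"
    using h unfolding p_def n_def by (intro integrable_max; simp)+
  have diff: "(\<integral>x. h x * w x \<partial>M) = (\<integral>x. p x * w x \<partial>M) - (\<integral>x. n x * w x \<partial>M)"
    if [measurable]: "w \<in> borel_measurable M" and w: "integrable M (\<lambda>x. h x * w x)" for w
  proof -
    have "integrable M (\<lambda>x. p x * w x)" "integrable M (\<lambda>x. n x * w x)"
      by (rule Bochner_Integration.integrable_bound[OF w];
          auto simp: p_def n_def abs_mult intro!: mult_right_mono)+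
    then show ?thesis
      unfolding h_eq by (simp add: left_diff_distrib)
  qed
  have "(\<integral>x. p x * k (Z x) \<partial>M) = (\<integral>x. n x * k (Z x) \<partial>M)"
  proof (rule fourier_uniqueness_nonneg[OF p n _ _ Z k])
    fix a \<phi>
    have "integrable M (\<lambda>x. h x * cos (a * Z x + \<phi>))"
      by (rule Bochner_Integration.integrable_bound[OF h]) (auto simp: abs_mult mult_left_le)
    then show "(\<integral>x. p x * cos (a * Z x + \<phi>) \<partial>M) = (\<integral>x. n x * cos (a * Z x + \<phi>) \<partial>M)"
      using zero[of a \<phi>] diff[of "\<lambda>x. cos (a * Z x + \<phi>)"] by simp
  qed (auto simp: p_def n_def)
  then show ?thesis
    using diff[of "\<lambda>x. k (Z x)"] int by simp
qed

lemma (in prob_space) gaussian_rv_square_integrable: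
  assumes "gaussian_rv M Y"
  shows "integrable M (\<lambda>\<omega>. (Y \<omega>)\<^sup>2)"
proof -
  have [measurable]: "Y \<in> borel_measurable M"
    using assms by (simp add: gaussian_rv_def)
  from assms consider m where "AE \<omega> in M. Y \<omega> = m"
    | m \<sigma> where "0 < \<sigma>" "distributed M lborel Y (normal_density m \<sigma>)"
    by (auto simp: gaussian_rv_def)
  then show ?thesis
  proof cases
    case 1
    then have "integrable M (\<lambda>\<omega>. (Y \<omega>)\<^sup>2) \<longleftrightarrow> integrable M (\<lambda>\<omega>. m\<^sup>2)"
      by (intro integrable_cong_AE) auto
    then show ?thesis by simp
  next
    case 2
    \<comment> \<open>The identity
      \<open>x\<^sup>2 = (x - m)\<^sup>2 + 2 * m * x - m\<^sup>2\<close> reduces the second moment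
      to moments whose integrability is known.\<close>
    have "integrable lborel (\<lambda>x. normal_density m \<sigma> x * (x - m)\<^sup>2 + 2 * m * (normal_density m \<sigma> x * x)
      - m\<^sup>2 * normal_density m \<sigma> x)"
      using integrable_normal_moment[OF 2(1), of m 2] integrable_normal_moment_nz_1[OF 2(1), of m]
        integrable_normal_density[OF 2(1)] by auto
    also have "(\<lambda>x. normal_density m \<sigma> x * (x - m)\<^sup>2 + 2 * m * (normal_density m \<sigma> x * x)
      - m\<^sup>2 * normal_density m \<sigma> x) = (\<lambda>x. normal_density m \<sigma> x * x\<^sup>2)"
      by (auto simp: power2_eq_square algebra_simps)
    finally show ?thesis
      using distributed_integrable[OF 2(2), of "\<lambda>x. x\<^sup>2"] by simp
  qed
qed

text \<open>This is the real part of \<open>exp (\<i> * \<phi>)\<close> times the characteristic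
  function at 1. The sine of \<open>Y\<close> has expectation 0 because the characteristic function
  of a centred normal law is real. A point mass has to sit at 0 and fits in with variance 0.\<close>

lemma (in prob_space) gaussian_rv_expectation_cos:
  assumes Y: "gaussian_rv M Y" and mean: "expectation Y = 0"
  shows "expectation (\<lambda>\<omega>. cos (Y \<omega> + \<phi>)) = cos \<phi> * exp (- expectation (\<lambda>\<omega>. (Y \<omega>)\<^sup>2) / 2)"
proof -
  have [measurable]: "Y \<in> borel_measurable M"
    using Y by (simp add: gaussian_rv_def)
  from Y consider m where "AE \<omega> in M. Y \<omega> = m"
    | m \<sigma> where "0 < \<sigma>" "distributed M lborel Y (normal_density m \<sigma>)"
    by (auto simp: gaussian_rv_def)
  then show ?thesis
  proof cases
    case 1
    have "expectation Y = expectation (\<lambda>\<omega>. m)"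
      using 1 by (intro integral_cong_AE) auto
    then have "m = 0"
      using mean by (simp add: prob_space)
    moreover have "expectation (\<lambda>\<omega>. (Y \<omega>)\<^sup>2) = expectation (\<lambda>\<omega>. m\<^sup>2)"
      "expectation (\<lambda>\<omega>. cos (Y \<omega> + \<phi>)) = expectation (\<lambda>\<omega>. cos (m + \<phi>))"
      using 1 by (intro integral_cong_AE; force)+
    ultimately show ?thesis
      by (simp add: prob_space)
  next
    case 2
    have m: "m = 0"
      using normal_distributed_expectation[OF 2] mean by simp
    have var: "expectation (\<lambda>\<omega>. (Y \<omega>)\<^sup>2) = \<sigma>\<^sup>2"
      using normal_distributed_variance[OF 2] mean by simp
    have "distributed M lborel (\<lambda>\<omega>. Y \<omega> / \<sigma>) std_normal_density"
      using 2 normal_standard_normal_convert[OF 2(1), of Y 0] m by simp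
    then have D: "distr M lborel (\<lambda>\<omega>. Y \<omega> / \<sigma>) = density lborel std_normal_density"
      by (rule distributed_distr_eq_density)
    have int: "integrable M (\<lambda>\<omega>. iexp (Y \<omega>))"
      by (rule integrable_const_bound[where B=1]) auto
    have "complex_of_real (exp (- (\<sigma>\<^sup>2) / 2)) = char std_normal_distribution \<sigma>"
      by (simp add: char_std_normal_distribution)
    also have "\<dots> = (\<integral>x. iexp (\<sigma> * x) \<partial>distr M lborel (\<lambda>\<omega>. Y \<omega> / \<sigma>))"
      by (simp add: char_def D)
    also have "\<dots> = (\<integral>\<omega>. iexp (Y \<omega>) \<partial>M)"
      using 2(1) by (subst integral_distr) auto
    finally have char: "(\<integral>\<omega>. iexp (Y \<omega>) \<partial>M) = complex_of_real (exp (- (\<sigma>\<^sup>2) / 2))"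
      by simp
    have "expectation (\<lambda>\<omega>. cos (Y \<omega>)) = exp (- (\<sigma>\<^sup>2) / 2)"
      using integral_Re[OF int] char by (simp add: Re_exp)
    moreover have "expectation (\<lambda>\<omega>. sin (Y \<omega>)) = 0"
      using integral_Im[OF int] char by (simp add: Im_exp)
    moreover have "integrable M (\<lambda>\<omega>. cos (Y \<omega>))" "integrable M (\<lambda>\<omega>. sin (Y \<omega>))"
      by (auto intro!: integrable_const_bound[where B=1])
    ultimately show ?thesis
      by (simp add: cos_add var)
  qed
qed

section \<open>Centred Gaussian processes\<close>

text \<open>Keeps products of cosines of linear combinations within the span of such cosines, whose
  expectations are explicit for centred Gaussian variables.\<close>

lemma cos_times_cos_shifted:
  "cos (x + \<phi>) * cos (y + \<psi>) =
    (cos ((x + y) + (\<phi> + \<psi>)) + cos ((x - y) + (\<phi> - \<psi>))) / 2" for x y \<phi> \<psi> :: real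
  by (subst cos_times_cos) (simp add: algebra_simps)

lemma integrable_mult_bounded:
  fixes h b :: "'a \<Rightarrow> real"
  assumes "integrable M h" "b \<in> borel_measurable M" "\<And>x. \<bar>b x\<bar> \<le> 1"
  shows "integrable M (\<lambda>x. h x * b x)"
  by (rule Bochner_Integration.integrable_bound[OF assms(1)])
     (use assms in \<open>auto simp: abs_mult mult_left_le\<close>)

lemma space_generated_sigma [simp]: "space (generated_sigma M X S) = space M"
  unfolding generated_sigma_def by (rule space_measure_of) auto

lemma sets_generated_sigma:
  "sets (generated_sigma M X S) =
    sigma_sets (space M) {X u -` A \<inter> space M | u A. u \<in> S \<and> A \<in> sets borel}"
  unfolding generated_sigma_def by (rule sets_measure_of) auto

lemma measurable_generated_sigma [measurable]:
  "u \<in> S \<Longrightarrow> X u \<in> borel_measurable (generated_sigma M X S)"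
  by (rule measurableI) (auto simp: sets_generated_sigma intro!: sigma_sets.Basic)

section \<open>Linear combinations of the values of a process\<close>

locale centered_gaussian_process = prob_space M for M :: "'a measure" +
  fixes T :: "real set" and X :: "real \<Rightarrow> 'a \<Rightarrow> real"
  assumes gaussian: "gaussian_process M T X"
    and zero_mean: "t \<in> T \<Longrightarrow> expectation (X t) = 0"
begin

lemma X_measurable [measurable]: "t \<in> T \<Longrightarrow> X t \<in> borel_measurable M"
  using gaussian by (simp add: gaussian_process_def)

text \<open>The linear span of the values at times in \<open>S\<close>, made of functions and
  without closure in the L2 norm: for \<open>S = T\<close> these are exactly the variables that
  \<open>gaussian_process\<close> declares normal.\<close>

definition lin_comb :: "real set \<Rightarrow> ('a \<Rightarrow> real) set" where
  "lin_comb S = {\<lambda>\<omega>. \<Sum>t\<in>I. c t * X t \<omega> | I c. finite I \<and> I \<subseteq> S}"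

lemma lin_comb_zero: "(\<lambda>\<omega>. 0) \<in> lin_comb S"
  unfolding lin_comb_def by (intro CollectI exI[of _ "{}"]) auto

lemma lin_comb_base: "t \<in> S \<Longrightarrow> X t \<in> lin_comb S"
  unfolding lin_comb_def by (intro CollectI exI[of _ "{t}"] exI[of _ "\<lambda>_. 1"]) auto

lemma lin_comb_mono: "S \<subseteq> S' \<Longrightarrow> lin_comb S \<subseteq> lin_comb S'"
  unfolding lin_comb_def by blast

lemma lin_comb_scale:
  assumes "W \<in> lin_comb S"
  shows "(\<lambda>\<omega>. a * W \<omega>) \<in> lin_comb S"
proof -
  obtain I c where "finite I" "I \<subseteq> S" "W = (\<lambda>\<omega>. \<Sum>t\<in>I. c t * X t \<omega>)"
    using assms by (auto simp: lin_comb_def)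
  then show ?thesis
    unfolding lin_comb_def
    by (intro CollectI exI[of _ I] exI[of _ "\<lambda>t. a * c t"]) (auto simp: sum_distrib_left mult.assoc)
qed

lemma lin_comb_add:
  assumes "V \<in> lin_comb S" "W \<in> lin_comb S"
  shows "(\<lambda>\<omega>. V \<omega> + W \<omega>) \<in> lin_comb S"
proof -
  obtain I c where V: "finite I" "I \<subseteq> S" "V = (\<lambda>\<omega>. \<Sum>t\<in>I. c t * X t \<omega>)"
    using assms(1) by (auto simp: lin_comb_def)
  obtain J d where W: "finite J" "J \<subseteq> S" "W = (\<lambda>\<omega>. \<Sum>t\<in>J. d t * X t \<omega>)"
    using assms(2) by (auto simp: lin_comb_def)
  let ?e = "\<lambda>t. (if t \<in> I then c t else 0) + (if t \<in> J then d t else 0)"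
  have "(\<Sum>t\<in>I \<union> J. ?e t * X t \<omega>) = V \<omega> + W \<omega>" for \<omega>
  proof -
    have "(\<Sum>t\<in>I \<union> J. ?e t * X t \<omega>) =
        (\<Sum>t\<in>I \<union> J. if t \<in> I then c t * X t \<omega> else 0) + (\<Sum>t\<in>I \<union> J. if t \<in> J then d t * X t \<omega> else 0)"
      unfolding sum.distrib[symmetric] by (intro sum.cong) (auto simp: algebra_simps)
    also have "\<dots> = V \<omega> + W \<omega>"
      using V W by (simp add: sum.inter_restrict[symmetric] Int_absorb1 Int_absorb2 Int_commute)
    finally show ?thesis .
  qed
  then show ?thesis
    unfolding lin_comb_def using V W
    by (intro CollectI exI[of _ "I \<union> J"] exI[of _ ?e]) auto
qed

lemma lin_comb_diff:
  "V \<in> lin_comb S \<Longrightarrow> W \<in> lin_comb S \<Longrightarrow> (\<lambda>\<omega>. V \<omega> - W \<omega>) \<in> lin_comb S"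
  using lin_comb_add[of V S "\<lambda>\<omega>. - 1 * W \<omega>"] lin_comb_scale[of W S "-1"] by simp

lemma lin_comb_gaussian: "W \<in> lin_comb T \<Longrightarrow> gaussian_rv M W"
  using gaussian by (auto simp: lin_comb_def gaussian_process_def)

lemma lin_comb_measurable [measurable]: "W \<in> lin_comb T \<Longrightarrow> W \<in> borel_measurable M"
  using lin_comb_gaussian by (auto simp: gaussian_rv_def)

lemma lin_comb_square_integrable: "W \<in> lin_comb T \<Longrightarrow> integrable M (\<lambda>\<omega>. (W \<omega>)\<^sup>2)"
  by (intro gaussian_rv_square_integrable lin_comb_gaussian)

lemma lin_comb_integrable: "W \<in> lin_comb T \<Longrightarrow> integrable M W"
  using square_integrable_imp_integrable lin_comb_square_integrable lin_comb_measurable by blast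

lemma lin_comb_mult_integrable:
  assumes [measurable]: "V \<in> lin_comb T" "W \<in> lin_comb T"
  shows "integrable M (\<lambda>\<omega>. V \<omega> * W \<omega>)"
proof (rule Bochner_Integration.integrable_bound)
  show "integrable M (\<lambda>\<omega>. (V \<omega>)\<^sup>2 + (W \<omega>)\<^sup>2)"
    using assms lin_comb_square_integrable by auto
  have "\<bar>x * y\<bar> \<le> x\<^sup>2 + y\<^sup>2" for x y :: real
    using sum_squares_bound[of x y] sum_squares_bound[of x "-y"] by (auto simp: abs_real_def)
  then show "AE \<omega> in M. norm (V \<omega> * W \<omega>) \<le> norm ((V \<omega>)\<^sup>2 + (W \<omega>)\<^sup>2)"
    by simp
qed measurable

lemma lin_comb_mean:
  assumes "W \<in> lin_comb T"
  shows "expectation W = 0"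
proof -
  obtain I c where "finite I" "I \<subseteq> T" "W = (\<lambda>\<omega>. \<Sum>t\<in>I. c t * X t \<omega>)"
    using assms by (auto simp: lin_comb_def)
  moreover have "integrable M (\<lambda>\<omega>. c t * X t \<omega>)" if "t \<in> T" for t
    using that by (auto intro!: lin_comb_integrable lin_comb_base)
  ultimately show ?thesis
    using zero_mean by (simp add: subset_iff)
qed

lemma lin_comb_uncorrelated:
  assumes Y: "Y \<in> lin_comb T" and S: "S \<subseteq> T"
    and zero: "\<And>u. u \<in> S \<Longrightarrow> expectation (\<lambda>\<omega>. Y \<omega> * X u \<omega>) = 0"
    and W: "W \<in> lin_comb S"
  shows "expectation (\<lambda>\<omega>. Y \<omega> * W \<omega>) = 0"
proof -
  obtain I c where I: "finite I" "I \<subseteq> S" "W = (\<lambda>\<omega>. \<Sum>t\<in>I. c t * X t \<omega>)"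
    using W by (auto simp: lin_comb_def)
  have "integrable M (\<lambda>\<omega>. Y \<omega> * X t \<omega>)" if "t \<in> I" for t
    using that I S Y by (intro lin_comb_mult_integrable lin_comb_base) auto
  then have "integrable M (\<lambda>\<omega>. c t * (Y \<omega> * X t \<omega>))" if "t \<in> I" for t
    using that by auto
  moreover have "(\<lambda>\<omega>. Y \<omega> * W \<omega>) = (\<lambda>\<omega>. \<Sum>t\<in>I. c t * (Y \<omega> * X t \<omega>))"
    by (simp add: I sum_distrib_left mult_ac)
  ultimately show ?thesis
    using I zero by (simp add: subset_iff)
qed

text \<open>Variances of uncorrelated summands add, so the Gaussian factor of the normal variable
  \<open>V + W\<close> splits and \<open>V\<close> acts like an independent summand.\<close>

lemma expectation_cos_add_uncorrelated:
  assumes V: "V \<in> lin_comb T" and W: "W \<in> lin_comb T"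
    and zero: "expectation (\<lambda>\<omega>. V \<omega> * W \<omega>) = 0"
  shows "expectation (\<lambda>\<omega>. cos (V \<omega> + W \<omega> + \<phi>)) =
    exp (- expectation (\<lambda>\<omega>. (V \<omega>)\<^sup>2) / 2) * expectation (\<lambda>\<omega>. cos (W \<omega> + \<phi>))"
proof -
  have "expectation (\<lambda>\<omega>. (V \<omega> + W \<omega>)\<^sup>2) = expectation (\<lambda>\<omega>. ((V \<omega>)\<^sup>2 + (W \<omega>)\<^sup>2) + 2 * (V \<omega> * W \<omega>))"
    by (simp add: power2_sum mult.assoc)
  also have "\<dots> = expectation (\<lambda>\<omega>. (V \<omega>)\<^sup>2) + expectation (\<lambda>\<omega>. (W \<omega>)\<^sup>2)"
    using V W zero lin_comb_mult_integrable lin_comb_square_integrable by simp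
  finally have var: "expectation (\<lambda>\<omega>. (V \<omega> + W \<omega>)\<^sup>2) =
      expectation (\<lambda>\<omega>. (V \<omega>)\<^sup>2) + expectation (\<lambda>\<omega>. (W \<omega>)\<^sup>2)" .
  have VW: "(\<lambda>\<omega>. V \<omega> + W \<omega>) \<in> lin_comb T"
    using V W by (rule lin_comb_add)
  have exp_split: "exp (- (a + b) / 2) = exp (- a / 2) * exp (- b / 2)" for a b :: real
    by (simp add: mult_exp_exp add_divide_distrib)
  show ?thesis
    unfolding gaussian_rv_expectation_cos[OF lin_comb_gaussian[OF VW] lin_comb_mean[OF VW]]
      gaussian_rv_expectation_cos[OF lin_comb_gaussian[OF W] lin_comb_mean[OF W]] var exp_split
    by (simp only: mult_ac)
qed

section \<open>Conditional expectation given the values at a set of times\<close>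

lemma subalgebra_generated_sigma:
  assumes "S \<subseteq> T"
  shows "subalgebra M (generated_sigma M X S)"
  unfolding subalgebra_def sets_generated_sigma
  using assms by (auto intro!: sets.sigma_sets_subset measurable_sets[OF X_measurable])

lemma generated_sigma_sigma_finite:
  assumes "S \<subseteq> T"
  shows "sigma_finite_subalgebra M (generated_sigma M X S)"
  using subalgebra_generated_sigma[OF assms] finite_measure_axioms
  by (intro finite_measure_subalgebra_is_sigma_finite)
     (simp add: finite_measure_subalgebra_def finite_measure_subalgebra_axioms_def)

text \<open>Induction on the set of constrained coordinates. Each new constraint
  \<open>X j \<in> B j\<close> concerns \<open>X j\<close> alone, so Fourier uniqueness in that one
  variable suffices. The cosine factor in the claim strengthens the induction: multiplying it by
  \<open>cos (a * X j + \<phi>)\<close> yields cosines of other elements of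
  \<open>lin_comb S\<close>.\<close>

lemma cylinder_integral_zero:
  assumes S: "S \<subseteq> T" and h: "integrable M h"
    and zero: "\<And>W \<psi>. W \<in> lin_comb S \<Longrightarrow> expectation (\<lambda>\<omega>. h \<omega> * cos (W \<omega> + \<psi>)) = 0"
    and "finite J" "J \<subseteq> S" "\<And>j. j \<in> J \<Longrightarrow> B j \<in> sets borel" "W \<in> lin_comb S"
  shows "expectation (\<lambda>\<omega>. h \<omega> * indicator {\<omega>\<in>space M. \<forall>j\<in>J. X j \<omega> \<in> B j} \<omega> * cos (W \<omega> + \<psi>)) = 0"
  using assms(4-)
proof (induction J arbitrary: W \<psi> rule: finite_induct)
  case empty
  have "expectation (\<lambda>\<omega>. h \<omega> * indicator (space M) \<omega> * cos (W \<omega> + \<psi>)) =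
      expectation (\<lambda>\<omega>. h \<omega> * cos (W \<omega> + \<psi>))"
    by (intro Bochner_Integration.integral_cong) auto
  then show ?case
    using zero empty by simp
next
  case (insert j J)
  define C where "C = {\<omega>\<in>space M. \<forall>j\<in>J. X j \<omega> \<in> B j}"
  define h' where "h' \<omega> = h \<omega> * indicator C \<omega>" for \<omega>
  have XM [measurable]: "\<And>i. i \<in> insert j J \<Longrightarrow> X i \<in> borel_measurable M"
    using insert S by auto
  have [measurable]: "\<And>i. i \<in> insert j J \<Longrightarrow> B i \<in> sets borel"
    using insert by auto
  have "C \<in> sets M"
    unfolding C_def using \<open>finite J\<close> by (intro sets.sets_Collect_finite_All) auto
  then have h': "integrable M h'"
    unfolding h'_def using h by (intro integrable_mult_bounded) auto
  have [measurable]: "W \<in> borel_measurable M"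
    using insert.prems(3) lin_comb_mono[OF S] by auto
  have h'W: "integrable M (\<lambda>\<omega>. h' \<omega> * cos (U \<omega> + c))" if "U \<in> lin_comb S" for U c
    using h' that lin_comb_mono[OF S] by (intro integrable_mult_bounded) auto
  have "expectation (\<lambda>\<omega>. (h' \<omega> * cos (W \<omega> + \<psi>)) * indicator (B j) (X j \<omega>)) = 0"
  proof (rule fourier_uniqueness[where h = "\<lambda>\<omega>. h' \<omega> * cos (W \<omega> + \<psi>)" and Z = "X j" and k = "indicator (B j)"])
    show "integrable M (\<lambda>\<omega>. h' \<omega> * cos (W \<omega> + \<psi>))"
      using h'W insert.prems by blast
    from integrable_mult_bounded[OF this, of "\<lambda>\<omega>. indicator (B j) (X j \<omega>)"]
    show "integrable M (\<lambda>\<omega>. h' \<omega> * cos (W \<omega> + \<psi>) * indicator (B j) (X j \<omega>))"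
      by auto
    fix a \<phi>
    let ?V = "\<lambda>\<omega>. W \<omega> + a * X j \<omega>" and ?U = "\<lambda>\<omega>. W \<omega> - a * X j \<omega>"
    have VU: "?V \<in> lin_comb S" "?U \<in> lin_comb S"
      using insert.prems by (auto intro!: lin_comb_add lin_comb_diff lin_comb_scale lin_comb_base)
    have "expectation (\<lambda>\<omega>. h' \<omega> * cos (W \<omega> + \<psi>) * cos (a * X j \<omega> + \<phi>)) =
        expectation (\<lambda>\<omega>. (h' \<omega> * cos (?V \<omega> + (\<psi> + \<phi>)) + h' \<omega> * cos (?U \<omega> + (\<psi> - \<phi>))) / 2)"
      unfolding mult.assoc cos_times_cos_shifted by (simp add: algebra_simps)
    also have "\<dots> = 0"
      using h'W[OF VU(1)] h'W[OF VU(2)] insert.IH[OF _ _ VU(1)] insert.IH[OF _ _ VU(2)] insert.prems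
      by (simp add: h'_def C_def)
    finally show "expectation (\<lambda>\<omega>. h' \<omega> * cos (W \<omega> + \<psi>) * cos (a * X j \<omega> + \<phi>)) = 0" .
  qed auto
  also have "expectation (\<lambda>\<omega>. (h' \<omega> * cos (W \<omega> + \<psi>)) * indicator (B j) (X j \<omega>)) =
    expectation (\<lambda>\<omega>. h \<omega> * indicator {\<omega>\<in>space M. \<forall>j\<in>insert j J. X j \<omega> \<in> B j} \<omega> * cos (W \<omega> + \<psi>))"
    by (intro Bochner_Integration.integral_cong) (auto simp: h'_def C_def indicator_def)
  finally show ?case .
qed

text \<open>The cylinder sets are stable under intersection and generate the sigma-algebra, and
  \<open>h\<close> integrates to 0 over each of them; Dynkin's argument extends this to every set of
  the sigma-algebra.\<close>

lemma cond_exp_zero: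
  assumes S: "S \<subseteq> T" and h: "integrable M h"
    and zero: "\<And>W \<psi>. W \<in> lin_comb S \<Longrightarrow> expectation (\<lambda>\<omega>. h \<omega> * cos (W \<omega> + \<psi>)) = 0"
  shows "AE \<omega> in M. real_cond_exp M (generated_sigma M X S) h \<omega> = 0"
proof -
  define G where "G = {{\<omega>\<in>space M. \<forall>j\<in>J. X j \<omega> \<in> B j} | J B.
      finite J \<and> J \<subseteq> S \<and> (\<forall>j. B j \<in> sets (borel :: real measure))}"
  let ?E = "{X u -` A \<inter> space M | u A. u \<in> S \<and> A \<in> sets borel}"
  interpret F: sigma_finite_subalgebra M "generated_sigma M X S"
    using generated_sigma_sigma_finite[OF S] .
  have [measurable]: "h \<in> borel_measurable M"
    using h by auto
  have "Int_stable G"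
  proof (rule Int_stableI)
    fix a b assume "a \<in> G" "b \<in> G"
    then obtain J B K C where
      a: "a = {\<omega>\<in>space M. \<forall>j\<in>J. X j \<omega> \<in> B j}" "finite J" "J \<subseteq> S" "\<And>j. B j \<in> sets (borel :: real measure)" and
      b: "b = {\<omega>\<in>space M. \<forall>j\<in>K. X j \<omega> \<in> C j}" "finite K" "K \<subseteq> S" "\<And>j. C j \<in> sets (borel :: real measure)"
      unfolding G_def by blast
    let ?D = "\<lambda>j. (if j \<in> J then B j else UNIV) \<inter> (if j \<in> K then C j else UNIV)"
    have "a \<inter> b = {\<omega>\<in>space M. \<forall>j\<in>J \<union> K. X j \<omega> \<in> ?D j}"
      unfolding a b by auto
    moreover have "\<forall>j. ?D j \<in> sets borel"
      using a b by auto
    ultimately show "a \<inter> b \<in> G"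
      unfolding G_def using a b by (intro CollectI exI[of _ "J \<union> K"] exI[of _ ?D]) auto
  qed
  moreover have "G \<subseteq> Pow (space M)"
    unfolding G_def by auto
  moreover have gen: "sets (generated_sigma M X S) \<subseteq> sigma_sets (space M) G"
    unfolding sets_generated_sigma
  proof (rule sigma_sets_mono)
    show "?E \<subseteq> sigma_sets (space M) G"
    proof
      fix b assume "b \<in> ?E"
      then obtain u A where "b = X u -` A \<inter> space M" "u \<in> S" "A \<in> sets borel"
        by auto
      then have "b \<in> G"
        unfolding G_def by (intro CollectI exI[of _ "{u}"] exI[of _ "\<lambda>_. A"]) auto
      then show "b \<in> sigma_sets (space M) G" ..
    qed
  qed
  ultimately have main: "expectation (\<lambda>\<omega>. indicator A \<omega> * h \<omega>) = 0"
    if A: "A \<in> sets (generated_sigma M X S)" for A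
  proof -
    have G_M: "G \<subseteq> sets M"
    proof
      fix a assume "a \<in> G"
      then obtain J B where
        a: "a = {\<omega>\<in>space M. \<forall>j\<in>J. X j \<omega> \<in> B j}" "finite J" "J \<subseteq> S" "\<And>j. B j \<in> sets (borel :: real measure)"
        unfolding G_def by blast
      show "a \<in> sets M"
        unfolding a(1) using a S
        by (intro sets.sets_Collect_finite_All) (auto intro!: measurable_sets_Collect[OF X_measurable])
    qed
    have sig_M: "sigma_sets (space M) G \<subseteq> sets M"
      by (rule sets.sigma_sets_subset[OF G_M])
    have int: "integrable M (\<lambda>\<omega>. indicator A \<omega> * h \<omega>)" if "A \<in> sets M" for A
      using integrable_mult_bounded[OF h, of "indicator A"] that by (simp add: mult.commute)
    \<comment> \<open>The zero combination with phase 0 has cosine 1. The vanishing total integral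
      is what closes the class under complements.\<close>
    have total: "expectation h = 0"
      using zero[OF lin_comb_zero, of 0] by simp
    have "A \<in> sigma_sets (space M) G"
      using A gen by auto
    with \<open>Int_stable G\<close> \<open>G \<subseteq> Pow (space M)\<close> show ?thesis
    proof (induction rule: sigma_sets_induct_disjoint)
      case (basic A)
      then obtain J B where
        a: "A = {\<omega>\<in>space M. \<forall>j\<in>J. X j \<omega> \<in> B j}" "finite J" "J \<subseteq> S" "\<And>j. B j \<in> sets (borel :: real measure)"
        unfolding G_def by blast
      show ?case
        using cylinder_integral_zero[OF S h zero a(2,3) a(4) lin_comb_zero, where \<psi> = 0]
        by (simp add: a(1) mult.commute)
    next
      case empty
      show ?case by simp
    next
      case (compl A)
      have "expectation (\<lambda>\<omega>. indicator (space M - A) \<omega> * h \<omega>) = expectation (\<lambda>\<omega>. h \<omega> - indicator A \<omega> * h \<omega>)"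
        by (intro Bochner_Integration.integral_cong) (auto simp: indicator_def)
      then show ?case
        using compl int sig_M h total by (auto simp: subset_iff)
    next
      case (union A)
      have M: "A i \<in> sets M" for i
        using union sig_M by auto
      have "(\<integral>\<omega>\<in>(\<Union>i. A i). h \<omega> \<partial>M) = (\<Sum>i. \<integral>\<omega>\<in>A i. h \<omega> \<partial>M)"
        using M union(1) h int[of "\<Union>i. A i"]
        by (intro lebesgue_integral_countable_add) (auto simp: set_integrable_def disjoint_family_on_def)
      then show ?case
        using union by (simp add: set_lebesgue_integral_def)
    qed
  qed
  show ?thesis
    by (rule F.real_cond_exp_charact) (use main h in \<open>auto simp: set_lebesgue_integral_def\<close>)
qed

end

section \<open>The Markov property as a regression identity\<close>

lemma generated_sigma_singleton:
  "generated_sigma M X {t} = vimage_algebra (space M) (X t) borel"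
  unfolding generated_sigma_def vimage_algebra_def by (rule arg_cong[where f = "sigma (space M)"]) auto

lemma subalgebra_generated_sigma_mono:
  assumes "S \<subseteq> S'"
  shows "subalgebra (generated_sigma M X S') (generated_sigma M X S)"
  unfolding subalgebra_def sets_generated_sigma
  using assms by (auto intro!: sigma_sets_mono')

context centered_gaussian_process
begin

text \<open>After the product formula \<open>Y\<close> occurs added to \<open>V + W\<close> and to
  \<open>V - W\<close>. It is uncorrelated with both, so both terms release the same factor, and the
  product formula can be undone.\<close>

lemma expectation_cos_decorrelate:
  assumes Y: "Y \<in> lin_comb T" and V: "V \<in> lin_comb T" and W: "W \<in> lin_comb T"
    and YV: "expectation (\<lambda>\<omega>. Y \<omega> * V \<omega>) = 0" and YW: "expectation (\<lambda>\<omega>. Y \<omega> * W \<omega>) = 0"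
  shows "expectation (\<lambda>\<omega>. cos (Y \<omega> + V \<omega> + \<phi>) * cos (W \<omega> + \<psi>)) =
    exp (- expectation (\<lambda>\<omega>. (Y \<omega>)\<^sup>2) / 2) * expectation (\<lambda>\<omega>. cos (V \<omega> + \<phi>) * cos (W \<omega> + \<psi>))"
proof -
  let ?k = "exp (- expectation (\<lambda>\<omega>. (Y \<omega>)\<^sup>2) / 2)"
  note lin = lin_comb_add[OF V W] lin_comb_diff[OF V W]
  have int: "integrable M (\<lambda>\<omega>. cos (U \<omega> + c))" if "U \<in> lin_comb T" for U and c :: real
    using that by (intro integrable_const_bound[where B=1]) auto
  have zero: "expectation (\<lambda>\<omega>. Y \<omega> * (V \<omega> + W \<omega>)) = 0" "expectation (\<lambda>\<omega>. Y \<omega> * (V \<omega> - W \<omega>)) = 0"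
    using YV YW lin_comb_mult_integrable[OF Y V] lin_comb_mult_integrable[OF Y W]
    by (simp_all add: algebra_simps)
  have "expectation (\<lambda>\<omega>. cos (Y \<omega> + V \<omega> + \<phi>) * cos (W \<omega> + \<psi>)) =
      expectation (\<lambda>\<omega>. (cos (Y \<omega> + (V \<omega> + W \<omega>) + (\<phi> + \<psi>)) + cos (Y \<omega> + (V \<omega> - W \<omega>) + (\<phi> - \<psi>))) / 2)"
    unfolding cos_times_cos_shifted by (simp add: add.assoc add_diff_eq)
  also have "\<dots> = (?k * expectation (\<lambda>\<omega>. cos ((V \<omega> + W \<omega>) + (\<phi> + \<psi>))) +
      ?k * expectation (\<lambda>\<omega>. cos ((V \<omega> - W \<omega>) + (\<phi> - \<psi>)))) / 2"
    using int[OF lin_comb_add[OF Y lin(1)]] int[OF lin_comb_add[OF Y lin(2)]]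
      expectation_cos_add_uncorrelated[OF Y lin(1) zero(1)]
      expectation_cos_add_uncorrelated[OF Y lin(2) zero(2)]
    by simp
  also have "\<dots> = ?k * ((expectation (\<lambda>\<omega>. cos ((V \<omega> + W \<omega>) + (\<phi> + \<psi>))) +
      expectation (\<lambda>\<omega>. cos ((V \<omega> - W \<omega>) + (\<phi> - \<psi>)))) / 2)"
    by (simp add: distrib_left)
  also have "\<dots> = ?k * expectation (\<lambda>\<omega>. cos (V \<omega> + \<phi>) * cos (W \<omega> + \<psi>))"
    unfolding cos_times_cos_shifted using int[OF lin(1)] int[OF lin(2)] by simp
  finally show ?thesis .
qed

text \<open>By decorrelation the centred variable \<open>cos (W \<omega> + \<psi>) - m\<close> is
  orthogonal to every \<open>cos (b * D \<omega> + \<phi>)\<close>, and Fourier uniqueness with the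
  identity for \<open>k\<close> makes it orthogonal to \<open>D\<close>. The term with
  \<open>m\<close> disappears because \<open>D\<close> has mean 0.\<close>

lemma expectation_mult_cos_uncorrelated:
  assumes D: "D \<in> lin_comb T" and W: "W \<in> lin_comb T"
    and zero: "expectation (\<lambda>\<omega>. D \<omega> * W \<omega>) = 0"
  shows "expectation (\<lambda>\<omega>. D \<omega> * cos (W \<omega> + \<psi>)) = 0"
proof -
  define m where "m = expectation (\<lambda>\<omega>. cos (W \<omega> + \<psi>))"
  let ?h = "\<lambda>\<omega>. cos (W \<omega> + \<psi>) - m"
  have [measurable]: "D \<in> borel_measurable M" "W \<in> borel_measurable M"
    using D W by auto
  have int: "integrable M (\<lambda>\<omega>. cos (W \<omega> + \<psi>))"
    by (intro integrable_const_bound[where B=1]) auto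
  have intD: "integrable M (\<lambda>\<omega>. D \<omega> * cos (W \<omega> + \<psi>))"
    using lin_comb_integrable[OF D] by (intro integrable_mult_bounded) auto
  have "expectation (\<lambda>\<omega>. ?h \<omega> * D \<omega>) = 0"
  proof (rule fourier_uniqueness[where h = ?h and Z = D and k = "\<lambda>x. x"])
    show "integrable M (\<lambda>\<omega>. ?h \<omega> * D \<omega>)"
      using intD lin_comb_integrable[OF D] by (simp add: algebra_simps)
  next
    fix b \<phi>
    let ?bD = "\<lambda>\<omega>. b * D \<omega>"
    have "expectation (\<lambda>\<omega>. W \<omega> * ?bD \<omega>) = 0"
      using zero lin_comb_mult_integrable[OF D W]
      by (simp add: mult.left_commute mult.commute[of "W _" "D _"])
    then have *: "expectation (\<lambda>\<omega>. cos (W \<omega> + \<psi>) * cos (?bD \<omega> + \<phi>)) =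
        exp (- expectation (\<lambda>\<omega>. (W \<omega>)\<^sup>2) / 2) * (cos \<psi> * expectation (\<lambda>\<omega>. cos (?bD \<omega> + \<phi>)))"
      using expectation_cos_decorrelate[OF W lin_comb_zero lin_comb_scale[OF D], of b \<psi> \<phi>] by simp
    have "m = cos \<psi> * exp (- expectation (\<lambda>\<omega>. (W \<omega>)\<^sup>2) / 2)"
      unfolding m_def using W by (intro gaussian_rv_expectation_cos lin_comb_gaussian lin_comb_mean)
    moreover have "integrable M (\<lambda>\<omega>. cos (W \<omega> + \<psi>) * cos (?bD \<omega> + \<phi>))"
      using int by (intro integrable_mult_bounded) auto
    moreover have "integrable M (\<lambda>\<omega>. cos (?bD \<omega> + \<phi>))"
      by (intro integrable_const_bound[where B=1]) auto
    ultimately show "expectation (\<lambda>\<omega>. ?h \<omega> * cos (b * D \<omega> + \<phi>)) = 0"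
      using * by (simp add: left_diff_distrib)
  qed (use int in auto)
  also have "expectation (\<lambda>\<omega>. ?h \<omega> * D \<omega>) =
      expectation (\<lambda>\<omega>. D \<omega> * cos (W \<omega> + \<psi>) - m * D \<omega>)"
    by (simp add: algebra_simps)
  finally show ?thesis
    using intD lin_comb_integrable[OF D] lin_comb_mean[OF D] by simp
qed

text \<open>The residual \<open>Y = X t - c * X s\<close> is uncorrelated with every
  \<open>X u\<close>, \<open>u \<in> S\<close>. So given the values on \<open>S\<close>,
  \<open>cos (a * X t + \<phi>)\<close> has a multiple of \<open>cos (a * c * X s + \<phi>)\<close>
  as conditional expectation, a function of \<open>X s\<close> alone. Fourier uniqueness in
  \<open>X t\<close> carries this over from cosines to the indicator of \<open>A\<close>.\<close>

lemma cond_prob_eq_if_regression: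
  assumes S: "S \<subseteq> T" and s: "s \<in> S" and t: "t \<in> T" and A [measurable]: "A \<in> sets borel"
    and regression: "\<And>u. u \<in> S \<Longrightarrow> expectation (\<lambda>\<omega>. (X t \<omega> - c * X s \<omega>) * X u \<omega>) = 0"
  shows "AE \<omega> in M.
    real_cond_exp M (generated_sigma M X S) (\<lambda>\<omega>. indicator A (X t \<omega>)) \<omega> =
    real_cond_exp M (generated_sigma M X {s}) (\<lambda>\<omega>. indicator A (X t \<omega>)) \<omega>"
proof -
  let ?F = "generated_sigma M X S" and ?G = "generated_sigma M X {s}"
  let ?ind = "\<lambda>\<omega>. indicator A (X t \<omega>) :: real"
  interpret F: sigma_finite_subalgebra M ?F
    using S by (rule generated_sigma_sigma_finite)
  interpret G: sigma_finite_subalgebra M ?G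
    using S s by (intro generated_sigma_sigma_finite) auto
  have G_F: "f \<in> borel_measurable ?F" if "f \<in> borel_measurable ?G" for f :: "'a \<Rightarrow> real"
    by (rule measurable_from_subalg[OF subalgebra_generated_sigma_mono that]) (use s in auto)
  have sT: "s \<in> T"
    using S s by auto
  have [measurable]: "X s \<in> borel_measurable M" "X t \<in> borel_measurable M" "X s \<in> borel_measurable ?G"
    using sT t by auto
  have int_ind: "integrable M ?ind"
    by (intro integrable_const_bound[where B=1]) auto
  define Y where "Y \<omega> = X t \<omega> - c * X s \<omega>" for \<omega>
  have Y: "Y \<in> lin_comb T"
    unfolding Y_def using sT t by (intro lin_comb_diff lin_comb_scale lin_comb_base)
  define p where "p = real_cond_exp M ?G ?ind"
  have [measurable]: "p \<in> borel_measurable M" "p \<in> borel_measurable ?G"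
    unfolding p_def by auto
  have p: "integrable M p"
    unfolding p_def using int_ind by (rule G.real_cond_exp_int)

  have main: "expectation (\<lambda>\<omega>. indicator B \<omega> * ?ind \<omega>) = expectation (\<lambda>\<omega>. indicator B \<omega> * p \<omega>)"
    if B: "B \<in> sets ?F" for B
  proof -
    have [measurable]: "B \<in> sets M"
      using B F.subalg by (auto simp: subalgebra_def)
    have int_B: "integrable M (indicator B :: 'a \<Rightarrow> real)"
      by (intro integrable_const_bound[where B=1]) auto
    define e where "e = real_cond_exp M ?G (indicator B)"
    \<comment> \<open>\<open>d\<close> is the part of \<open>indicator B\<close> that is orthogonal
      to bounded functions of \<open>X s\<close>. The heart of the proof is that it is also
      orthogonal to the indicator of \<open>X t \<in> A\<close>.\<close>
    define d where "d \<omega> = indicator B \<omega> - e \<omega>" for \<omega>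
    have [measurable]: "e \<in> borel_measurable M" "e \<in> borel_measurable ?G"
      unfolding e_def by auto
    have e: "integrable M e"
      unfolding e_def using int_B by (rule G.real_cond_exp_int)
    have [measurable]: "d \<in> borel_measurable M"
      unfolding d_def by measurable
    have d: "integrable M d"
      unfolding d_def using int_B e by auto
    have dF: "d \<in> borel_measurable ?F"
      unfolding d_def using B by (intro borel_measurable_diff G_F borel_measurable_indicator) auto
    have "expectation (\<lambda>\<omega>. d \<omega> * indicator A (X t \<omega>)) = 0"
    proof (rule fourier_uniqueness[where h = d and Z = "X t" and k = "indicator A"])
      show "integrable M (\<lambda>\<omega>. d \<omega> * indicator A (X t \<omega>))"
        using d by (intro integrable_mult_bounded) auto
      fix a \<phi>
      \<comment> \<open>\<open>k\<close> is the value at 1 of the characteristic function of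
        \<open>a * Y\<close>, the factor by which the residual damps the cosine; with it the
        conditional expectation of \<open>h\<close> vanishes.\<close>
      define k where "k = exp (- expectation (\<lambda>\<omega>. (a * Y \<omega>)\<^sup>2) / 2)"
      define h where "h \<omega> = cos (a * X t \<omega> + \<phi>) - k * cos (a * c * X s \<omega> + \<phi>)" for \<omega>
      have [measurable]: "h \<in> borel_measurable M"
        unfolding h_def by measurable
      have h: "integrable M h"
        unfolding h_def
        by (intro Bochner_Integration.integrable_diff integrable_mult_right integrable_const_bound[where B=1]) auto
      have int_dX: "integrable M (\<lambda>\<omega>. d \<omega> * cos (a * X t \<omega> + \<phi>))"
        "integrable M (\<lambda>\<omega>. d \<omega> * cos (a * c * X s \<omega> + \<phi>))"
        using d by (auto intro!: integrable_mult_bounded)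
      have dh_eq: "d \<omega> * h \<omega> = d \<omega> * cos (a * X t \<omega> + \<phi>) - k * (d \<omega> * cos (a * c * X s \<omega> + \<phi>))" for \<omega>
        by (simp add: h_def algebra_simps)
      have int_dh: "integrable M (\<lambda>\<omega>. d \<omega> * h \<omega>)"
        unfolding dh_eq using int_dX by auto
      have "AE \<omega> in M. real_cond_exp M ?F h \<omega> = 0"
      proof (rule cond_exp_zero[OF S h])
        fix W \<psi> assume W: "W \<in> lin_comb S"
        let ?V = "\<lambda>\<omega>. a * c * X s \<omega>" and ?Y = "\<lambda>\<omega>. a * Y \<omega>"
        have W_T: "W \<in> lin_comb T" and V: "?V \<in> lin_comb S"
          using W S s lin_comb_mono by (auto intro: lin_comb_scale lin_comb_base)
        then have V_T: "?V \<in> lin_comb T"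
          using S lin_comb_mono by auto
        have unc: "expectation (\<lambda>\<omega>. ?Y \<omega> * U \<omega>) = 0" if "U \<in> lin_comb S" for U
          using lin_comb_uncorrelated[OF Y S _ that] regression lin_comb_mult_integrable[OF Y, of U]
            that S lin_comb_mono by (simp add: Y_def mult.assoc)
        have [measurable]: "W \<in> borel_measurable M"
          using W_T by auto
        have Vt: "?Y \<omega> + ?V \<omega> = a * X t \<omega>" for \<omega>
          by (simp add: Y_def algebra_simps)
        have "expectation (\<lambda>\<omega>. cos (a * X t \<omega> + \<phi>) * cos (W \<omega> + \<psi>)) =
            k * expectation (\<lambda>\<omega>. cos (a * c * X s \<omega> + \<phi>) * cos (W \<omega> + \<psi>))"
          using expectation_cos_decorrelate[OF lin_comb_scale[OF Y] V_T W_T unc[OF V] unc[OF W]]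
          unfolding Vt k_def by simp
        moreover have "integrable M (\<lambda>\<omega>. cos (a * X t \<omega> + \<phi>) * cos (W \<omega> + \<psi>))"
          "integrable M (\<lambda>\<omega>. cos (a * c * X s \<omega> + \<phi>) * cos (W \<omega> + \<psi>))"
          by (intro integrable_mult_bounded integrable_const_bound[where B=1]; auto)+
        ultimately show "expectation (\<lambda>\<omega>. h \<omega> * cos (W \<omega> + \<psi>)) = 0"
          by (simp add: h_def left_diff_distrib mult.assoc)
      qed
      then have "expectation (\<lambda>\<omega>. d \<omega> * real_cond_exp M ?F h \<omega>) = 0"
        by (intro integral_eq_zero_AE) auto
      then have "expectation (\<lambda>\<omega>. d \<omega> * h \<omega>) = 0"
        using F.real_cond_exp_intg(2)[OF int_dh dF] by simp
      then have *: "expectation (\<lambda>\<omega>. d \<omega> * cos (a * X t \<omega> + \<phi>)) =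
          k * expectation (\<lambda>\<omega>. d \<omega> * cos (a * c * X s \<omega> + \<phi>))"
        unfolding dh_eq using int_dX by simp
      have int_cB: "integrable M (\<lambda>\<omega>. cos (a * c * X s \<omega> + \<phi>) * indicator B \<omega>)"
        by (intro integrable_mult_bounded integrable_const_bound[where B=1]; auto)
      have "expectation (\<lambda>\<omega>. cos (a * c * X s \<omega> + \<phi>) * e \<omega>) =
          expectation (\<lambda>\<omega>. cos (a * c * X s \<omega> + \<phi>) * indicator B \<omega>)"
        unfolding e_def using int_cB by (intro G.real_cond_exp_intg) auto
      moreover have "integrable M (\<lambda>\<omega>. cos (a * c * X s \<omega> + \<phi>) * e \<omega>)"
        unfolding e_def using int_cB by (intro G.real_cond_exp_intg) auto
      ultimately have "expectation (\<lambda>\<omega>. d \<omega> * cos (a * c * X s \<omega> + \<phi>)) = 0"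
        using int_cB by (simp add: d_def algebra_simps)
      with * show "expectation (\<lambda>\<omega>. d \<omega> * cos (a * X t \<omega> + \<phi>)) = 0"
        by simp
    qed (use d in auto)
    moreover have int_B_ind: "integrable M (\<lambda>\<omega>. indicator B \<omega> * ?ind \<omega>)"
      using int_B by (intro integrable_mult_bounded) auto
    moreover have int_e_ind: "integrable M (\<lambda>\<omega>. e \<omega> * ?ind \<omega>)"
      using e by (intro integrable_mult_bounded) auto
    ultimately have "expectation (\<lambda>\<omega>. indicator B \<omega> * ?ind \<omega>) = expectation (\<lambda>\<omega>. e \<omega> * ?ind \<omega>)"
      by (simp add: d_def left_diff_distrib)
    \<comment> \<open>Conditional expectation is self-adjoint: it is first moved onto
      \<open>?ind\<close>, as \<open>e\<close> is measurable for \<open>?G\<close>, and then taken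
      off \<open>indicator B\<close>, as \<open>p\<close> is.\<close>
    also have "\<dots> = expectation (\<lambda>\<omega>. e \<omega> * p \<omega>)"
      unfolding p_def using int_e_ind by (intro G.real_cond_exp_intg(2)[symmetric]) auto
    also have "\<dots> = expectation (\<lambda>\<omega>. p \<omega> * e \<omega>)"
      by (simp add: mult.commute)
    also have "\<dots> = expectation (\<lambda>\<omega>. p \<omega> * indicator B \<omega>)"
      unfolding e_def using p by (intro G.real_cond_exp_intg(2) integrable_mult_bounded) auto
    finally show ?thesis
      by (simp add: mult.commute)
  qed
  have "AE \<omega> in M. real_cond_exp M ?F ?ind \<omega> = p \<omega>"
  proof (rule F.real_cond_exp_charact)
    show "p \<in> borel_measurable ?F"
      by (rule G_F) measurable
  qed (simp_all add: set_lebesgue_integral_def main int_ind p)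
  then show ?thesis
    by (simp add: p_def)
qed

text \<open>\<open>D\<close> is the residual of \<open>X u\<close> after regression on
  \<open>X s\<close>, so its conditional expectation given \<open>X s\<close> is 0. Since
  \<open>D\<close> belongs to the past of \<open>s\<close>, the Markov property makes it orthogonal
  to all events in \<open>X t\<close>, and so to \<open>X t\<close> itself.\<close>

lemma regression_if_markov_property:
  assumes markov: "markov_property M T X"
    and u: "u \<in> T" and s: "s \<in> T" and t: "t \<in> T" and "u \<le> s" "s \<le> t"
  shows "expectation (\<lambda>\<omega>. X u \<omega> * X t \<omega>) =
    expectation (\<lambda>\<omega>. X u \<omega> * X s \<omega>) / expectation (\<lambda>\<omega>. X s \<omega> * X s \<omega>) * expectation (\<lambda>\<omega>. X s \<omega> * X t \<omega>)"
proof -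
  let ?F = "generated_sigma M X {u\<in>T. u \<le> s}" and ?G = "generated_sigma M X {s}"
  interpret F: sigma_finite_subalgebra M ?F
    by (rule generated_sigma_sigma_finite) auto
  interpret G: sigma_finite_subalgebra M ?G
    using s by (intro generated_sigma_sigma_finite) auto
  interpret H: sigma_finite_subalgebra M "generated_sigma M X {t}"
    using t by (intro generated_sigma_sigma_finite) auto
  have [measurable]: "X s \<in> borel_measurable M" "X t \<in> borel_measurable M" "X u \<in> borel_measurable M"
    using s t u by auto
  have int: "integrable M (\<lambda>\<omega>. X i \<omega> * X j \<omega>)" if "i \<in> T" "j \<in> T" for i j
    using that by (intro lin_comb_mult_integrable lin_comb_base)
  define b where "b = expectation (\<lambda>\<omega>. X u \<omega> * X s \<omega>) / expectation (\<lambda>\<omega>. X s \<omega> * X s \<omega>)"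
  define D where "D \<omega> = X u \<omega> - b * X s \<omega>" for \<omega>
  have D: "D \<in> lin_comb T"
    unfolding D_def using u s by (intro lin_comb_diff lin_comb_scale lin_comb_base)
  have [measurable]: "D \<in> borel_measurable M"
    using D by auto
  have DF: "D \<in> borel_measurable ?F"
    unfolding D_def using u s assms(5)
    by (intro borel_measurable_diff borel_measurable_times measurable_generated_sigma) auto
  have Ds: "expectation (\<lambda>\<omega>. D \<omega> * X s \<omega>) = 0"
  \<comment> \<open>For zero variance the quotient \<open>b\<close> is 0 by convention, and the
    claim holds because \<open>X s\<close> vanishes almost everywhere.\<close>
  proof (cases "expectation (\<lambda>\<omega>. X s \<omega> * X s \<omega>) = 0")
    case True
    then have "AE \<omega> in M. X s \<omega> * X s \<omega> = 0"
      using int[OF s s] by (subst (asm) integral_nonneg_eq_0_iff_AE) auto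
    then show ?thesis
      by (intro integral_eq_zero_AE) auto
  next
    case False
    have "expectation (\<lambda>\<omega>. D \<omega> * X s \<omega>) =
        expectation (\<lambda>\<omega>. X u \<omega> * X s \<omega>) - b * expectation (\<lambda>\<omega>. X s \<omega> * X s \<omega>)"
      using int u s by (simp add: D_def left_diff_distrib mult.assoc)
    with False show ?thesis
      by (simp add: b_def)
  qed
  have DG: "AE \<omega> in M. real_cond_exp M ?G D \<omega> = 0"
  proof (rule cond_exp_zero)
    fix W \<psi> assume W: "W \<in> lin_comb {s}"
    have "W \<in> lin_comb T"
      using W s lin_comb_mono[of "{s}" T] by auto
    moreover have "expectation (\<lambda>\<omega>. D \<omega> * W \<omega>) = 0"
      using lin_comb_uncorrelated[OF D _ _ W] Ds s by simp
    ultimately show "expectation (\<lambda>\<omega>. D \<omega> * cos (W \<omega> + \<psi>)) = 0"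
      by (rule expectation_mult_cos_uncorrelated[OF D])
  qed (use s D lin_comb_integrable in auto)
  have DA: "expectation (\<lambda>\<omega>. D \<omega> * indicator A (X t \<omega>)) = 0" if A [measurable]: "A \<in> sets borel" for A
  proof -
    let ?ind = "\<lambda>\<omega>. indicator A (X t \<omega>) :: real"
    have int_ind: "integrable M (\<lambda>\<omega>. D \<omega> * ?ind \<omega>)"
      using lin_comb_integrable[OF D] by (intro integrable_mult_bounded) auto
    have eq: "AE \<omega> in M. real_cond_exp M ?F ?ind \<omega> = real_cond_exp M ?G ?ind \<omega>"
      using markov s t assms(6) A unfolding markov_property_def by blast
    have "integrable M (\<lambda>\<omega>. D \<omega> * real_cond_exp M ?F ?ind \<omega>)"
      using int_ind DF by (intro F.real_cond_exp_intg) auto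
    then have int_pD: "integrable M (\<lambda>\<omega>. real_cond_exp M ?G ?ind \<omega> * D \<omega>)"
      using eq by (subst (asm) integrable_cong_AE[where g = "\<lambda>\<omega>. real_cond_exp M ?G ?ind \<omega> * D \<omega>"]) auto
    have "expectation (\<lambda>\<omega>. D \<omega> * ?ind \<omega>) = expectation (\<lambda>\<omega>. D \<omega> * real_cond_exp M ?F ?ind \<omega>)"
      using int_ind DF by (intro F.real_cond_exp_intg(2)[symmetric]) auto
    also have "\<dots> = expectation (\<lambda>\<omega>. real_cond_exp M ?G ?ind \<omega> * D \<omega>)"
      using eq by (intro integral_cong_AE) auto
    also have "\<dots> = expectation (\<lambda>\<omega>. real_cond_exp M ?G ?ind \<omega> * real_cond_exp M ?G D \<omega>)"
      using int_pD by (intro G.real_cond_exp_intg(2)[symmetric]) auto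
    also have "\<dots> = 0"
      using DG by (intro integral_eq_zero_AE) auto
    finally show ?thesis .
  qed
  \<comment> \<open>Indicators of events in \<open>X t\<close> are bounded while \<open>X t\<close>
    is not; the conditional expectation of \<open>D\<close> given \<open>X t\<close> bridges the
    gap.\<close>
  have DH: "AE \<omega> in M. real_cond_exp M (generated_sigma M X {t}) D \<omega> = 0"
  proof (rule H.real_cond_exp_charact)
    fix B assume "B \<in> sets (generated_sigma M X {t})"
    then obtain A where A: "A \<in> sets borel" "B = X t -` A \<inter> space M"
      unfolding generated_sigma_singleton by (auto simp: sets_vimage_algebra2)
    have "(\<integral>\<omega>\<in>B. D \<omega> \<partial>M) = expectation (\<lambda>\<omega>. D \<omega> * indicator A (X t \<omega>))"
      unfolding set_lebesgue_integral_def A(2)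
      by (intro Bochner_Integration.integral_cong) (auto simp: indicator_def)
    then show "(\<integral>\<omega>\<in>B. D \<omega> \<partial>M) = (\<integral>\<omega>\<in>B. 0 \<partial>M)"
      using DA A by simp
  qed (use D lin_comb_integrable in auto)
  have "expectation (\<lambda>\<omega>. X t \<omega> * D \<omega>) = expectation (\<lambda>\<omega>. X t \<omega> * real_cond_exp M (generated_sigma M X {t}) D \<omega>)"
    using lin_comb_mult_integrable[OF lin_comb_base[OF t] D]
    by (intro H.real_cond_exp_intg(2)[symmetric]) auto
  also have "\<dots> = 0"
    using DH by (intro integral_eq_zero_AE) auto
  finally have "expectation (\<lambda>\<omega>. X u \<omega> * X t \<omega> - b * (X s \<omega> * X t \<omega>)) = 0"
    by (simp add: D_def algebra_simps)
  then show ?thesis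
    using int u s t by (simp add: b_def)
qed

end

section \<open>Second moments of pairs and regression coefficients\<close>

context centered_gaussian_process
begin

lemma expectation_square_lin_comb2:
  assumes "s \<in> T" "t \<in> T"
  shows "expectation (\<lambda>\<omega>. (a * X s \<omega> + b * X t \<omega>)\<^sup>2) =
    a\<^sup>2 * expectation (\<lambda>\<omega>. X s \<omega> * X s \<omega>) + b\<^sup>2 * expectation (\<lambda>\<omega>. X t \<omega> * X t \<omega>) +
    2 * a * b * expectation (\<lambda>\<omega>. X s \<omega> * X t \<omega>)"
proof -
  have int: "integrable M (\<lambda>\<omega>. X i \<omega> * X j \<omega>)" if "i \<in> T" "j \<in> T" for i j
    using that by (intro lin_comb_mult_integrable lin_comb_base)
  have "expectation (\<lambda>\<omega>. (a * X s \<omega> + b * X t \<omega>)\<^sup>2) = expectation (\<lambda>\<omega>.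
      a\<^sup>2 * (X s \<omega> * X s \<omega>) + b\<^sup>2 * (X t \<omega> * X t \<omega>) + 2 * a * b * (X s \<omega> * X t \<omega>))"
    by (simp add: power2_eq_square algebra_simps)
  then show ?thesis
    using int[OF assms(1,1)] int[OF assms(2,2)] int[OF assms] by simp
qed

text \<open>A square with expectation 0 vanishes almost everywhere. This turns a degenerate
  covariance matrix of two values into an almost sure linear relation, the form that
  \<open>nondegenerate\<close> forbids.\<close>

lemma lin_comb2_AE_zero:
  assumes "s \<in> T" "t \<in> T"
    and "a\<^sup>2 * expectation (\<lambda>\<omega>. X s \<omega> * X s \<omega>) + b\<^sup>2 * expectation (\<lambda>\<omega>. X t \<omega> * X t \<omega>) +
      2 * a * b * expectation (\<lambda>\<omega>. X s \<omega> * X t \<omega>) = 0"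
  shows "AE \<omega> in M. a * X s \<omega> + b * X t \<omega> = 0"
proof -
  have "(\<lambda>\<omega>. a * X s \<omega> + b * X t \<omega>) \<in> lin_comb T"
    using assms by (intro lin_comb_add lin_comb_scale lin_comb_base)
  then have "integrable M (\<lambda>\<omega>. (a * X s \<omega> + b * X t \<omega>)\<^sup>2)"
    by (rule lin_comb_square_integrable)
  then have "AE \<omega> in M. (a * X s \<omega> + b * X t \<omega>)\<^sup>2 = 0"
    using assms(3) expectation_square_lin_comb2[OF assms(1,2), of a b]
    by (subst integral_nonneg_eq_0_iff_AE[symmetric]) simp_all
  then show ?thesis
    by simp
qed

text \<open>One coefficient \<open>c\<close> has to serve every earlier time \<open>u\<close>; then
  \<open>X t - c * X s\<close> is uncorrelated with the whole past of \<open>s\<close>.\<close>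

lemma markov_property_if_regression:
  assumes "\<And>s t. s \<in> T \<Longrightarrow> t \<in> T \<Longrightarrow> s \<le> t \<Longrightarrow>
    \<exists>c. \<forall>u\<in>T. u \<le> s \<longrightarrow> expectation (\<lambda>\<omega>. X u \<omega> * X t \<omega>) = c * expectation (\<lambda>\<omega>. X u \<omega> * X s \<omega>)"
  shows "markov_property M T X"
  unfolding markov_property_def
proof (intro ballI impI)
  fix s t and A :: "real set"
  assume s: "s \<in> T" and t: "t \<in> T" and "s \<le> t" and A: "A \<in> sets borel"
  have int: "integrable M (\<lambda>\<omega>. X i \<omega> * X j \<omega>)" if "i \<in> T" "j \<in> T" for i j
    using that by (intro lin_comb_mult_integrable lin_comb_base)
  obtain c where c: "\<And>u. u \<in> T \<Longrightarrow> u \<le> s \<Longrightarrow>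
      expectation (\<lambda>\<omega>. X u \<omega> * X t \<omega>) = c * expectation (\<lambda>\<omega>. X u \<omega> * X s \<omega>)"
    using assms[OF s t \<open>s \<le> t\<close>] by blast
  have "expectation (\<lambda>\<omega>. (X t \<omega> - c * X s \<omega>) * X u \<omega>) = 0" if u: "u \<in> {u\<in>T. u \<le> s}" for u
  proof -
    have "expectation (\<lambda>\<omega>. (X t \<omega> - c * X s \<omega>) * X u \<omega>) =
        expectation (\<lambda>\<omega>. X u \<omega> * X t \<omega> - c * (X u \<omega> * X s \<omega>))"
      by (simp add: algebra_simps)
    also have "\<dots> = 0"
      using u c int s t by simp
    finally show ?thesis .
  qed
  then show "AE \<omega> in M.
      real_cond_exp M (generated_sigma M X {u\<in>T. u \<le> s}) (\<lambda>\<omega>. indicator A (X t \<omega>)) \<omega> =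
      real_cond_exp M (generated_sigma M X {s}) (\<lambda>\<omega>. indicator A (X t \<omega>)) \<omega>"
    using s t A by (intro cond_prob_eq_if_regression) auto
qed

end

section \<open>The variance of a Markov process with stationary increments\<close>

lemma C2_on_open_interval:
  assumes "C2_on S f" "{a<..<b} \<subseteq> S"
  obtains f' f'' where "\<And>x. x \<in> {a<..<b} \<Longrightarrow> (f has_real_derivative f' x) (at x)"
    "\<And>x. x \<in> {a<..<b} \<Longrightarrow> (f' has_real_derivative f'' x) (at x)"
proof -
  obtain f' f'' where *: "\<forall>x\<in>S. (f has_real_derivative f' x) (at x within S) \<and>
      (f' has_real_derivative f'' x) (at x within S)"
    using assms(1) unfolding C2_on_def by (elim exE conjE)
  have at: "at x = at x within {a<..<b}" if "x \<in> {a<..<b}" for x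
    using that at_within_open[of x "{a<..<b}"] by simp
  have "(f has_real_derivative f' x) (at x)" "(f' has_real_derivative f'' x) (at x)"
    if x: "x \<in> {a<..<b}" for x
    unfolding at[OF x] using bspec[OF * subsetD[OF assms(2) x]] DERIV_subset[OF _ assms(2)] by blast+
  then show thesis
    by (rule that)
qed

lemma C2_on_continuous: "C2_on S f \<Longrightarrow> continuous_on S f"
  unfolding C2_on_def by (blast intro: DERIV_continuous_on)

lemma DERIV_at_right_unique:
  fixes f :: "real \<Rightarrow> real"
  assumes "(f has_real_derivative D) (at_right x)" "(f has_real_derivative E) (at_right x)"
  shows "D = E"
  using assms unfolding has_field_derivative_iff
  by (intro tendsto_unique[where F = "at_right x"]) auto

text \<open>Only the values on \<open>{a..b}\<close> matter, so identities valid only to the right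
  of \<open>a\<close>, such as the covariance formula for \<open>s \<le> t\<close>, can still be
  differentiated.\<close>

lemma DERIV_at_right_transform:
  fixes f g :: "real \<Rightarrow> real"
  assumes "(f has_real_derivative D) (at_right a)" "a < b" "\<And>x. x \<in> {a..b} \<Longrightarrow> f x = g x"
  shows "(g has_real_derivative D) (at_right a)"
proof -
  have "(f has_real_derivative D) (at a within {a..b})"
    using assms by (simp add: at_within_Icc_at_right)
  then have "(g has_real_derivative D) (at a within {a..b})"
    by (rule has_field_derivative_transform_within[where d = 1]) (use assms in auto)
  then show ?thesis
    using assms by (simp add: at_within_Icc_at_right)
qed

text \<open>The probability is stripped off. What remains is an interval of times that starts at 0
  and has no greatest element, stationarity as \<open>cov_eq\<close>, and the Markov property as
  \<open>markov\<close>, with the quotient read as 0 where \<open>v s = 0\<close>.\<close>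

locale markov_variogram =
  fixes T :: "real set" and r :: "real \<Rightarrow> real \<Rightarrow> real" and v :: "real \<Rightarrow> real"
  assumes zero_mem: "0 \<in> T" and nonneg: "t \<in> T \<Longrightarrow> 0 \<le> t"
    and down: "t \<in> T \<Longrightarrow> 0 \<le> s \<Longrightarrow> s \<le> t \<Longrightarrow> s \<in> T"
    and up: "t \<in> T \<Longrightarrow> \<exists>t'\<in>T. t < t'"
    and cov_eq: "s \<in> T \<Longrightarrow> t \<in> T \<Longrightarrow> s \<le> t \<Longrightarrow> r s t = (v s + v t - v (t - s)) / 2"
    and markov: "u \<in> T \<Longrightarrow> s \<in> T \<Longrightarrow> t \<in> T \<Longrightarrow> u \<le> s \<Longrightarrow> s \<le> t \<Longrightarrow> r u t = r u s / v s * r s t"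
    and v_zero: "v 0 = 0" and v_nonneg: "t \<in> T \<Longrightarrow> 0 \<le> v t"
begin

text \<open>
  At a zero \<open>s\<close> of the variance the junk value \<open>r u s / 0 = 0\<close> is the right regression
  coefficient, so past and future of \<open>s\<close> are uncorrelated.
\<close>
lemma variance_add_across_zero:
  assumes "u \<in> T" "s \<in> T" "t \<in> T" "u \<le> s" "s \<le> t" "v s = 0"
  shows "v (t - u) = v u + v t"
  using markov[OF assms(1-5)] cov_eq[OF assms(1,3)] assms by simp

text \<open>If \<open>v s = 0\<close> and \<open>x\<close> is small, additivity across
  \<open>s\<close> gives \<open>0 = v x + v (s + x)\<close>, and nonnegativity kills both terms.
  From this initial interval of zeros the vanishing spreads in steps of length
  \<open>e\<close>.\<close>

lemma variance_vanishes:
  assumes s: "s \<in> T" "0 < s" "v s = 0" and "t \<in> T"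
  shows "v t = 0"
proof -
  obtain t' where t': "t' \<in> T" "s < t'"
    using up[OF s(1)] by blast
  \<comment> \<open>\<open>e \<le> s\<close> puts \<open>x\<close> before \<open>s\<close>, and
    \<open>s + e \<le> t'\<close> keeps \<open>s + x\<close> in \<open>T\<close>.\<close>
  define e where "e = min s (t' - s)"
  have e: "0 < e" "e \<in> T"
    using s t' by (auto simp: e_def intro: down[OF t'(1)])
  have small: "v x = 0" if x: "0 \<le> x" "x \<le> e" for x
  proof -
    have mem: "x \<in> T" "s + x \<in> T" "x \<le> s"
      using x s t' by (auto simp: e_def intro: down[OF t'(1)])
    have "v (s + x - x) = v x + v (s + x)"
      using x mem s by (intro variance_add_across_zero) auto
    then show ?thesis
      using s v_nonneg[OF mem(1)] v_nonneg[OF mem(2)] by simp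
  qed
  have "\<forall>t\<in>T. t \<le> real n * e \<longrightarrow> v t = 0" for n
  proof (induction n)
    case 0
    then show ?case
      using nonneg v_zero by (metis mult_zero_left of_nat_0 order_antisym)
  next
    case (Suc n)
    show ?case
    proof (intro ballI impI)
      fix t assume t: "t \<in> T" "t \<le> real (Suc n) * e"
      show "v t = 0"
      proof (cases "t \<le> e")
        case True
        then show ?thesis
          using small nonneg[OF t(1)] by simp
      next
        case False
        have "t - e \<in> T" "t - e \<le> real n * e"
          using False e t by (auto simp: algebra_simps intro: down[OF t(1)])
        \<comment> \<open>\<open>e\<close> is itself a zero of the variance and lies before
          \<open>t\<close>, so additivity holds across it.\<close>
        moreover have "v (t - e) = v e + v t"
          using False e t small by (intro variance_add_across_zero) auto
        ultimately show ?thesis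
          using Suc small[of e] e by simp
      qed
    qed
  qed
  moreover obtain n where "t / e \<le> real n"
    using real_arch_simple by blast
  ultimately show ?thesis
    using \<open>t \<in> T\<close> e by (simp add: pos_divide_le_eq)
qed

end

text \<open>The alternative left by \<open>variance_vanishes\<close>: a variance without zeros at
  positive times.\<close>

locale smooth_markov_variogram = markov_variogram +
  assumes smooth: "smooth_covariance T r"
    and v_pos: "t \<in> T \<Longrightarrow> 0 < t \<Longrightarrow> 0 < v t"
begin

lemma cov_diag: "t \<in> T \<Longrightarrow> r t t = v t"
  using cov_eq[of t t] v_zero by simp

text \<open>
  Away from the diagonal the covariance is smooth, and the Markov property writes the variance
  \<open>v x\<close> as \<open>r u x * r x t / r u t\<close>.
\<close>
lemma variance_locally_C2:
  assumes s: "s \<in> T" "0 < s"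
  obtains a b f' f'' where "a < s" "s < b"
    "\<And>x. x \<in> {a<..<b} \<Longrightarrow> (v has_real_derivative f' x) (at x)"
    "\<And>x. x \<in> {a<..<b} \<Longrightarrow> (f' has_real_derivative f'' x) (at x)"
proof -
  have pos: "0 < r s s"
    using cov_diag v_pos s by simp
  \<comment> \<open>On the diagonal \<open>r s s = v s\<close> is positive, so continuity in each
    argument separately yields \<open>u < s < t\<close> with \<open>r u s\<close> and
    \<open>r s t\<close> positive.\<close>
  have "continuous_on {x\<in>T. x \<le> s} (\<lambda>x. r x s)"
    using smooth s C2_on_continuous unfolding smooth_covariance_def by blast
  then have "((\<lambda>x. r x s) \<longlongrightarrow> r s s) (at s within {x\<in>T. x \<le> s})"
    using s by (auto simp: continuous_on_def)
  then have "eventually (\<lambda>x. 0 < r x s) (at s within {x\<in>T. x \<le> s})"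
    using pos by (rule order_tendstoD)
  then obtain e where "0 < e" "\<forall>x\<in>{x\<in>T. x \<le> s}. x \<noteq> s \<and> dist x s < e \<longrightarrow> 0 < r x s"
    unfolding eventually_at by blast
  then have e: "0 < e" "\<And>x. x \<in> T \<Longrightarrow> x < s \<Longrightarrow> s - x < e \<Longrightarrow> 0 < r x s"
    by (simp_all add: dist_real_def)
  define u where "u = max 0 (s - e / 2)"
  have u: "u \<in> T" "u < s" "0 < r u s"
  proof -
    show "u \<in> T" "u < s"
      using e s by (auto simp: u_def intro: down[OF s(1)])
    then show "0 < r u s"
      using e by (auto simp: u_def)
  qed
  have "continuous_on {x\<in>T. s \<le> x} (\<lambda>x. r s x)"
    using smooth s C2_on_continuous unfolding smooth_covariance_def by blast
  then have "((\<lambda>x. r s x) \<longlongrightarrow> r s s) (at s within {x\<in>T. s \<le> x})"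
    using s by (auto simp: continuous_on_def)
  then have "eventually (\<lambda>x. 0 < r s x) (at s within {x\<in>T. s \<le> x})"
    using pos by (rule order_tendstoD)
  then obtain e' where "0 < e'" "\<forall>x\<in>{x\<in>T. s \<le> x}. x \<noteq> s \<and> dist x s < e' \<longrightarrow> 0 < r s x"
    unfolding eventually_at by blast
  then have e': "0 < e'" "\<And>x. x \<in> T \<Longrightarrow> s < x \<Longrightarrow> x - s < e' \<Longrightarrow> 0 < r s x"
    by (simp_all add: dist_real_def)
  obtain t' where t': "t' \<in> T" "s < t'"
    using up s by blast
  define t where "t = min t' (s + e' / 2)"
  have t: "t \<in> T" "s < t" "0 < r s t"
  proof -
    show "t \<in> T" "s < t"
      using e' s t' by (auto simp: t_def intro: down[OF t'(1)])
    then show "0 < r s t"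
      using e' by (auto simp: t_def)
  qed
  have rut: "0 < r u t"
    using markov[OF u(1) s(1) t(1)] u t v_pos[OF s] by simp
  \<comment> \<open>For \<open>x\<close> between \<open>u\<close> and \<open>t\<close> the pairs
    \<open>(u, x)\<close> and \<open>(x, t)\<close> stay on the side of the diagonal where the
    covariance is smooth.\<close>
  have sub: "{u<..<t} \<subseteq> {x\<in>T. x \<le> t}" "{u<..<t} \<subseteq> {x\<in>T. u \<le> x}"
    using u t nonneg[of u] by (auto intro: down[OF t(1)])
  have "C2_on {x\<in>T. x \<le> t} (\<lambda>x. r x t)" "C2_on {x\<in>T. u \<le> x} (\<lambda>x. r u x)"
    using smooth u t unfolding smooth_covariance_def by blast+
  note C2 = this
  obtain f' f'' where
    f: "\<And>x. x \<in> {u<..<t} \<Longrightarrow> ((\<lambda>x. r x t) has_real_derivative f' x) (at x)"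
      "\<And>x. x \<in> {u<..<t} \<Longrightarrow> (f' has_real_derivative f'' x) (at x)"
    using C2_on_open_interval[OF C2(1) sub(1)] by blast
  obtain g' g'' where
    g: "\<And>x. x \<in> {u<..<t} \<Longrightarrow> ((\<lambda>x. r u x) has_real_derivative g' x) (at x)"
      "\<And>x. x \<in> {u<..<t} \<Longrightarrow> (g' has_real_derivative g'' x) (at x)"
    using C2_on_open_interval[OF C2(2) sub(2)] by blast
  have v_eq: "r u x * r x t / r u t = v x" if "x \<in> {u<..<t}" for x
  proof -
    have x: "x \<in> T" "0 < x"
      using that sub nonneg[OF u(1)] by auto
    have "r u t * v x = r u x * r x t"
      using markov[OF u(1) x(1) t(1)] that v_pos[OF x] by simp
    then show ?thesis
      using rut by (simp add: field_simps)
  qed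
  show thesis
  proof (rule that)
    fix x assume x: "x \<in> {u<..<t}"
    have "((\<lambda>x. r u x * r x t / r u t) has_real_derivative (g' x * r x t + r u x * f' x) / r u t) (at x)"
      using f(1)[OF x] g(1)[OF x] rut by (auto intro!: derivative_eq_intros)
    then show "(v has_real_derivative (g' x * r x t + r u x * f' x) / r u t) (at x)"
      by (rule has_field_derivative_transform_within_open[where S = "{u<..<t}"]) (use x v_eq in auto)
    have "((\<lambda>x. g' x * r x t + r u x * f' x) has_real_derivative
        (g' x * f' x + g'' x * r x t) + (r u x * f'' x + g' x * f' x)) (at x)"
      by (intro DERIV_add DERIV_mult' f g x)
    then show "((\<lambda>x. (g' x * r x t + r u x * f' x) / r u t) has_real_derivative
        ((g' x * f' x + g'' x * r x t) + (r u x * f'' x + g' x * f' x)) / r u t) (at x)"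
      by (rule DERIV_cdivide)
  qed (use u t in auto)
qed

lemma variance_DERIV:
  assumes "s \<in> T" "0 < s"
  shows "(v has_real_derivative deriv v s) (at s)"
    and "(deriv v has_real_derivative deriv (deriv v) s) (at s)"
proof -
  obtain a b f' f'' where *: "a < s" "s < b"
    "\<And>x. x \<in> {a<..<b} \<Longrightarrow> (v has_real_derivative f' x) (at x)"
    "\<And>x. x \<in> {a<..<b} \<Longrightarrow> (f' has_real_derivative f'' x) (at x)"
    using variance_locally_C2[OF assms] by blast
  have s: "s \<in> {a<..<b}"
    using * by simp
  then show "(v has_real_derivative deriv v s) (at s)"
    using *(3) DERIV_imp_deriv by metis
  have "f' x = deriv v x" if "x \<in> {a<..<b}" for x
    using DERIV_imp_deriv[OF *(3)[OF that]] by simp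
  then have "(deriv v has_real_derivative f'' s) (at s)"
    by (intro has_field_derivative_transform_within_open[OF *(4)[OF s], of "{a<..<b}"]) (use s in auto)
  then show "(deriv v has_real_derivative deriv (deriv v) s) (at s)"
    using DERIV_imp_deriv by metis
qed

text \<open>Time 0 is out of reach of \<open>variance_locally_C2\<close>. Near it
  \<open>v x = 2 * r x t - v t + v (t - x)\<close> with a fixed \<open>t > 0\<close>; here
  \<open>r x t\<close> is differentiable from the right at 0, and \<open>v\<close> is differentiable
  at \<open>t\<close>.\<close>

lemma variance_DERIV_zero:
  obtains \<theta> where "(v has_real_derivative \<theta>) (at_right 0)"
proof -
  obtain t where t: "t \<in> T" "0 < t"
    using up[OF zero_mem] by blast
  have T: "{x\<in>T. x \<le> t} = {0..t}"
    using down[OF t(1)] nonneg by auto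
  have "C2_on {x\<in>T. x \<le> t} (\<lambda>x. r x t)"
    using smooth t unfolding smooth_covariance_def by blast
  then obtain g where "((\<lambda>x. r x t) has_real_derivative g) (at 0 within {0..t})"
    unfolding C2_on_def T using t by force
  then have g: "((\<lambda>x. r x t) has_real_derivative g) (at_right 0)"
    using t by (simp add: at_within_Icc_at_right)
  have "((\<lambda>x. v (t - x)) has_real_derivative deriv v t * (- 1)) (at 0)"
    by (rule DERIV_chain2[where f = v]) (use variance_DERIV[OF t] in \<open>auto intro!: derivative_eq_intros\<close>)
  then have "((\<lambda>x. v (t - x)) has_real_derivative - deriv v t) (at_right 0)"
    by (auto intro: has_field_derivative_at_within)
  with g have "((\<lambda>x. 2 * r x t - v t + v (t - x)) has_real_derivative 2 * g + - deriv v t) (at_right 0)"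
    by (auto intro!: derivative_eq_intros)
  then have "(v has_real_derivative 2 * g + - deriv v t) (at_right 0)"
    by (rule DERIV_at_right_transform[OF _ t(2)]) (simp_all add: field_simps cov_eq[OF down[OF t(1)] t(1)])
  then show thesis ..
qed

lemma variance_ode:
  assumes \<theta>: "(v has_real_derivative \<theta>) (at_right 0)" and s: "s \<in> T" "0 < s"
  shows "2 * deriv (deriv v) s * v s = (deriv v s)\<^sup>2 - \<theta>\<^sup>2"
proof -
  have slope: "((\<lambda>u. r u t) has_real_derivative (\<theta> + deriv v t) / 2) (at_right 0)"
    if t: "t \<in> T" "0 < t" for t
  proof -
    have "((\<lambda>x. v (t - x)) has_real_derivative deriv v t * (- 1)) (at 0)"
      by (rule DERIV_chain2[where f = v]) (use variance_DERIV[OF t] in \<open>auto intro!: derivative_eq_intros\<close>)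
    then have "((\<lambda>x. v (t - x)) has_real_derivative - deriv v t) (at_right 0)"
      by (auto intro: has_field_derivative_at_within)
    with \<theta> have "((\<lambda>x. (v x + v t - v (t - x)) / 2) has_real_derivative (\<theta> + deriv v t) / 2) (at_right 0)"
      by (auto intro!: derivative_eq_intros)
    then show ?thesis
      by (rule DERIV_at_right_transform[OF _ t(2)]) (simp_all add: cov_eq[OF down[OF t(1)] t(1)])
  qed
  \<comment> \<open>These are the right derivatives at \<open>u = 0\<close> of the two sides of the
    Markov identity, which holds for \<open>u\<close> in \<open>{0..s}\<close>.\<close>
  have slope_eq: "(\<theta> + deriv v t) / 2 * v s = (\<theta> + deriv v s) / 2 * r s t" if t: "t \<in> T" "s \<le> t" for t
  proof (rule DERIV_at_right_unique)
    show "((\<lambda>u. r u t * v s) has_real_derivative (\<theta> + deriv v t) / 2 * v s) (at_right 0)"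
      using slope[of t] t s by (auto intro!: derivative_eq_intros)
    have "((\<lambda>u. r u s * r s t) has_real_derivative (\<theta> + deriv v s) / 2 * r s t) (at_right 0)"
      using slope[OF s] by (auto intro!: derivative_eq_intros)
    then show "((\<lambda>u. r u t * v s) has_real_derivative (\<theta> + deriv v s) / 2 * r s t) (at_right 0)"
    proof (rule DERIV_at_right_transform[OF _ s(2)])
      fix u assume "u \<in> {0..s}"
      then have "r u t = r u s / v s * r s t"
        using down[OF s(1)] by (intro markov s t) auto
      then show "r u s * r s t = r u t * v s"
        using v_pos[OF s] by simp
    qed
  qed
  obtain t1 where t1: "t1 \<in> T" "s < t1"
    using up[OF s(1)] by blast
  have "(\<theta> + deriv v s) / 2 * ((deriv v s - \<theta>) / 2) = deriv (deriv v) s / 2 * v s"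
  proof (rule DERIV_at_right_unique)
    \<comment> \<open>At \<open>t = s\<close> the term \<open>v (t - s)\<close> has the right
      derivative of \<open>v\<close> at 0, so the chain rule is applied within
      \<open>{s..t1}\<close>. This is the source of the summand \<open>- \<theta>\<close>.\<close>
    have "(v has_real_derivative \<theta>) (at (s - s) within (\<lambda>t. t - s) ` {s..t1})"
      using \<theta> t1 by (simp add: at_within_Icc_at_right)
    then have "(v \<circ> (\<lambda>t. t - s) has_real_derivative \<theta> * 1) (at s within {s..t1})"
      by (rule DERIV_image_chain) (auto intro!: derivative_eq_intros)
    then have "((\<lambda>t. v (t - s)) has_real_derivative \<theta>) (at_right s)"
      using t1 by (simp add: at_within_Icc_at_right o_def)
    then show "((\<lambda>t. (\<theta> + deriv v s) / 2 * ((v s + v t - v (t - s)) / 2)) has_real_derivative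
        (\<theta> + deriv v s) / 2 * ((deriv v s - \<theta>) / 2)) (at_right s)"
      using variance_DERIV(1)[OF s, THEN has_field_derivative_at_within]
      by (auto intro!: derivative_eq_intros)
    have "((\<lambda>t. (\<theta> + deriv v t) / 2 * v s) has_real_derivative deriv (deriv v) s / 2 * v s) (at_right s)"
      using variance_DERIV(2)[OF s, THEN has_field_derivative_at_within]
      by (auto intro!: derivative_eq_intros)
    then show "((\<lambda>t. (\<theta> + deriv v s) / 2 * ((v s + v t - v (t - s)) / 2)) has_real_derivative
        deriv (deriv v) s / 2 * v s) (at_right s)"
    proof (rule DERIV_at_right_transform[OF _ t1(2)])
      fix t assume "t \<in> {s..t1}"
      then have "t \<in> T" "s \<le> t"
        using down[OF t1(1)] s by auto
      then show "(\<theta> + deriv v t) / 2 * v s = (\<theta> + deriv v s) / 2 * ((v s + v t - v (t - s)) / 2)"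
        using slope_eq[of t] cov_eq[OF s(1), of t] by simp
    qed
  qed
  then show ?thesis
    by (simp add: power2_eq_square algebra_simps)
qed

text \<open>Three integrations, each through a vanishing derivative: the first integral
  \<open>L\<close> of the differential equation, then the constants \<open>c\<close> and
  \<open>d\<close> that come with \<open>deriv v\<close> and \<open>v\<close>.\<close>

lemma variance_quadratic:
  obtains \<theta> K where "\<And>t. t \<in> T \<Longrightarrow> v t = \<theta> * t + K * t\<^sup>2"
proof -
  obtain \<theta> where \<theta>: "(v has_real_derivative \<theta>) (at_right 0)"
    using variance_DERIV_zero by blast
  \<comment> \<open>The derivatives of \<open>v\<close> are two-sided at positive times only;
    continuity at 0 fixes the last constant \<open>d\<close>.\<close>
  let ?I = "{t\<in>T. 0 < t}"
  have "convex T"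
    unfolding convex_alt
  proof (intro ballI allI impI)
    fix x y c :: real assume *: "x \<in> T" "y \<in> T" "0 \<le> c \<and> c \<le> 1"
    have "(1 - c) * x + c * y \<le> (1 - c) * max x y + c * max x y"
      using * by (intro add_mono mult_left_mono) auto
    then have "(1 - c) * x + c * y \<le> max x y"
      by (simp add: algebra_simps)
    moreover have "max x y \<in> T" "0 \<le> (1 - c) * x + c * y"
      using * nonneg by (auto simp: max_def)
    ultimately show "(1 - c) *\<^sub>R x + c *\<^sub>R y \<in> T"
      using down by auto
  qed
  moreover have "?I = T \<inter> {0<..}"
    by auto
  ultimately have I: "convex ?I"
    by (simp add: convex_Int)
  have const: "\<exists>c. \<forall>t\<in>?I. f t = c" if "\<And>t. t \<in> ?I \<Longrightarrow> (f has_real_derivative 0) (at t)" for f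
    using has_field_derivative_zero_constant[OF I, of f] that has_field_derivative_at_within by blast
  have q_const: "((\<lambda>t. ((deriv v t)\<^sup>2 - \<theta>\<^sup>2) / v t) has_real_derivative 0) (at t)" if t: "t \<in> ?I" for t
  proof -
    have "((\<lambda>t. ((deriv v t)\<^sup>2 - \<theta>\<^sup>2) / v t) has_real_derivative
        ((2 * deriv v t * deriv (deriv v) t) * v t - ((deriv v t)\<^sup>2 - \<theta>\<^sup>2) * deriv v t) / (v t * v t)) (at t)"
      using variance_DERIV[of t] v_pos[of t] t by (auto intro!: derivative_eq_intros)
    \<comment> \<open>The numerator of the quotient rule is \<open>deriv v t\<close> times the
      defect of the differential equation.\<close>
    moreover have "(2 * deriv v t * deriv (deriv v) t) * v t - ((deriv v t)\<^sup>2 - \<theta>\<^sup>2) * deriv v t =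
        deriv v t * (2 * deriv (deriv v) t * v t - ((deriv v t)\<^sup>2 - \<theta>\<^sup>2))"
      by (simp add: algebra_simps)
    moreover have "\<dots> = 0"
      using variance_ode[OF \<theta>, of t] t by simp
    ultimately show ?thesis
      by simp
  qed
  obtain L where L: "\<And>t. t \<in> ?I \<Longrightarrow> ((deriv v t)\<^sup>2 - \<theta>\<^sup>2) / v t = L"
    using const[OF q_const] by blast
  \<comment> \<open>The differential equation now says that the second derivative is
    \<open>L / 2\<close>, so the coefficient of \<open>t\<^sup>2\<close> is
    \<open>L / 4\<close>.\<close>
  define K where "K = L / 4"
  have w2: "deriv (deriv v) t = 2 * K" if t: "t \<in> ?I" for t
    using L[OF t] variance_ode[OF \<theta>, of t] v_pos[of t] t by (simp add: K_def field_simps)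
  have slope_const: "((\<lambda>t. deriv v t - 2 * K * t) has_real_derivative 0) (at t)" if t: "t \<in> ?I" for t
    using variance_DERIV(2)[of t] w2[OF t] t by (auto intro!: derivative_eq_intros)
  obtain c where c: "\<And>t. t \<in> ?I \<Longrightarrow> deriv v t - 2 * K * t = c"
    using const[OF slope_const] by blast
  have rest_const: "((\<lambda>t. v t - K * t\<^sup>2 - c * t) has_real_derivative 0) (at t)" if t: "t \<in> ?I" for t
    using variance_DERIV(1)[of t] c[OF t] t by (auto intro!: derivative_eq_intros)
  obtain d where d: "\<And>t. t \<in> ?I \<Longrightarrow> v t - K * t\<^sup>2 - c * t = d"
    using const[OF rest_const] by blast
  have "d = 0"
  proof (rule tendsto_unique)
    obtain t where t: "t \<in> T" "0 < t"
      using up[OF zero_mem] by blast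
    have "(v \<longlongrightarrow> v 0) (at_right 0)"
      using DERIV_continuous[OF \<theta>] by (simp add: continuous_within)
    then have "((\<lambda>t. v t - K * t\<^sup>2 - c * t) \<longlongrightarrow> v 0 - K * 0\<^sup>2 - c * 0) (at_right 0)"
      by (intro tendsto_intros) auto
    then show "((\<lambda>t. v t - K * t\<^sup>2 - c * t) \<longlongrightarrow> 0) (at_right 0)"
      by (simp add: v_zero)
    have "eventually (\<lambda>x. x \<in> {0<..<t}) (at_right 0)"
      using t by (simp add: eventually_at_right_field) (meson greaterThanLessThan_iff)
    then have "eventually (\<lambda>x. v x - K * x\<^sup>2 - c * x = d) (at_right 0)"
      by eventually_elim (use d down[OF t(1)] in auto)
    then show "((\<lambda>t. v t - K * t\<^sup>2 - c * t) \<longlongrightarrow> d) (at_right 0)"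
      by (rule tendsto_eventually)
  qed auto
  then have "v t = c * t + K * t\<^sup>2" if "t \<in> T" for t
    using d[of t] nonneg[OF that] that v_zero by (cases "t = 0") auto
  then show thesis ..
qed

end

text \<open>The bound on \<tau> expresses that \<open>\<theta> - \<tau> * t\<close> is never
  negative on the time interval. Leaving out the endpoint \<open>\<Delta>\<close> is harmless
  because the bound passes to the limit. For infinite \<open>\<Delta>\<close> the quotient is 0, and
  a linear function bounded above on the half-line has slope at most 0.\<close>

lemma ereal_le_divide_iff_bound:
  fixes \<theta> \<tau> :: real and \<Delta> :: ereal
  assumes "0 < \<theta>" "0 < \<Delta>"
  shows "ereal \<tau> \<le> ereal \<theta> / \<Delta> \<longleftrightarrow> (\<forall>t. 0 \<le> t \<and> ereal t < \<Delta> \<longrightarrow> \<tau> * t \<le> \<theta>)"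
proof (cases \<Delta>)
  case (real d)
  then have d: "0 < d"
    using assms by simp
  have "\<tau> * d \<le> \<theta> \<longleftrightarrow> (\<forall>t. 0 \<le> t \<and> t < d \<longrightarrow> \<tau> * t \<le> \<theta>)"
  proof
    assume le: "\<tau> * d \<le> \<theta>"
    show "\<forall>t. 0 \<le> t \<and> t < d \<longrightarrow> \<tau> * t \<le> \<theta>"
    proof (intro allI impI)
      fix t assume t: "0 \<le> t \<and> t < d"
      show "\<tau> * t \<le> \<theta>"
      proof (cases "0 \<le> \<tau>")
        case True
        then show ?thesis
          using t le mult_left_mono[of t d \<tau>] by simp
      next
        case False
        then show ?thesis
          using t assms(1) mult_nonpos_nonneg[of \<tau> t] by simp
      qed
    qed
  next
    assume bound: "\<forall>t. 0 \<le> t \<and> t < d \<longrightarrow> \<tau> * t \<le> \<theta>"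
    show "\<tau> * d \<le> \<theta>"
    proof (rule ccontr)
      assume "\<not> \<tau> * d \<le> \<theta>"
      then have less: "\<theta> < \<tau> * d" and "0 < \<tau>"
        using assms(1) d by (auto simp: not_le intro: zero_less_mult_pos2[of \<tau> d])
      then have "\<theta> / \<tau> < d" "0 < \<theta> / \<tau>"
        using assms(1) by (simp_all add: field_simps)
      \<comment> \<open>A bound that fails at \<open>d\<close> already fails at every
        \<open>t\<close> between \<open>\<theta> / \<tau>\<close> and \<open>d\<close>.\<close>
      then obtain t where t: "\<theta> / \<tau> < t" "t < d"
        using dense by blast
      then have "\<theta> < \<tau> * t"
        using \<open>0 < \<tau>\<close> by (simp add: field_simps)
      with bound t \<open>0 < \<theta> / \<tau>\<close> show False
        by (meson less_eq_real_def less_trans not_le)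
    qed
  qed
  then show ?thesis
    using real d by (simp add: pos_le_divide_eq)
next
  case PInf
  have "\<tau> \<le> 0 \<longleftrightarrow> (\<forall>t\<ge>0. \<tau> * t \<le> \<theta>)"
  proof
    assume "\<tau> \<le> 0"
    then have "\<tau> * t \<le> 0" if "0 \<le> t" for t
      using that by (simp add: mult_nonpos_nonneg)
    then show "\<forall>t\<ge>0. \<tau> * t \<le> \<theta>"
      using assms(1) by (meson less_imp_le order_trans)
  next
    assume bound: "\<forall>t\<ge>0. \<tau> * t \<le> \<theta>"
    show "\<tau> \<le> 0"
    proof (rule ccontr)
      assume "\<not> \<tau> \<le> 0"
      then show False
        using bound[rule_format, of "2 * \<theta> / \<tau>"] assms(1) by simp
    qed
  qed
  then show ?thesis
    using PInf by simp
qed (use assms in simp)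

section \<open>The characterisation\<close>

theorem theorem1:
  fixes M :: "'a measure"
    and X :: "real \<Rightarrow> 'a \<Rightarrow> real"
    and r :: "real \<Rightarrow> real \<Rightarrow> real"
    and \<Delta> :: ereal
    and T :: "real set"
  assumes "prob_space M"
    and "0 < \<Delta>"
    and T: "T = {t. 0 \<le> t \<and> ereal t < \<Delta>}"
    and gaussian: "gaussian_process M T X"
    and nondegenerate: "nondegenerate M T X"
    and zero_mean: "\<forall>t\<in>T. integral\<^sup>L M (X t) = 0"
    and continuous: "AE \<omega> in M. continuous_on T (\<lambda>t. X t \<omega>)"
    and start: "AE \<omega> in M. X 0 \<omega> = 0"
    and covariance: "\<forall>s\<in>T. \<forall>t\<in>T. s \<le> t \<longrightarrow> integral\<^sup>L M (\<lambda>\<omega>. X s \<omega> * X t \<omega>) = r s t"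
    and smooth: "smooth_covariance T r"
  shows "(stationary_increments M T X \<and> markov_property M T X) \<longleftrightarrow>
         (\<exists>\<theta> \<tau>. 0 < \<theta> \<and> ereal \<tau> \<le> ereal \<theta> / \<Delta> \<and>
            (\<forall>s\<in>T. \<forall>t\<in>T. s \<le> t \<longrightarrow> r s t = s * (\<theta> - \<tau> * t)))"
proof -
  interpret centered_gaussian_process M T X
    using assms(1) gaussian zero_mean
    by (simp add: centered_gaussian_process_def centered_gaussian_process_axioms_def)
  define v where "v t = r t t" for t
  have nonneg: "0 \<le> t" if "t \<in> T" for t
    using that by (simp add: T)
  have zero_mem: "0 \<in> T"
    using assms(2) by (simp add: T zero_ereal_def)
  have down: "s \<in> T" if "t \<in> T" "0 \<le> s" "s \<le> t" for s t
    using that by (simp add: T) (meson ereal_less_eq(3) le_less_trans)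
  have up: "\<exists>t'\<in>T. t < t'" if t: "t \<in> T" for t
  proof -
    have "ereal t < \<Delta>"
      using t by (simp add: T)
    then obtain t' where "t < t'" "ereal t' < \<Delta>"
      using ereal_dense2 by (metis ereal_less(2) less_ereal.simps(1))
    then show ?thesis
      using nonneg[OF t] by (intro bexI[of _ t']) (auto simp: T)
  qed
  have cov: "expectation (\<lambda>\<omega>. X s \<omega> * X t \<omega>) = r s t" if "s \<in> T" "t \<in> T" "s \<le> t" for s t
    using covariance that by blast
  have var: "expectation (\<lambda>\<omega>. X t \<omega> * X t \<omega>) = v t" if "t \<in> T" for t
    using cov that by (simp add: v_def)
  have v_nonneg: "0 \<le> v t" if "t \<in> T" for t
    unfolding var[OF that, symmetric] by (rule Bochner_Integration.integral_nonneg) simp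
  have v_zero: "v 0 = 0"
  proof -
    have "expectation (\<lambda>\<omega>. X 0 \<omega> * X 0 \<omega>) = 0"
      using start by (intro integral_eq_zero_AE) auto
    then show ?thesis
      using var[OF zero_mem] by simp
  qed
  have increment: "expectation (\<lambda>\<omega>. (X t \<omega> - X s \<omega>)\<^sup>2) = v s + v t - 2 * r s t"
    if "s \<in> T" "t \<in> T" "s \<le> t" for s t
    using expectation_square_lin_comb2[OF that(1,2), of "-1" 1] that by (simp add: var cov)

  show ?thesis
  proof

    \<comment> \<open>From the two properties to the covariance\<close>
    assume "stationary_increments M T X \<and> markov_property M T X"
    then have stationary: "stationary_increments M T X" and markov: "markov_property M T X"
      by auto
    have cov_eq: "r s t = (v s + v t - v (t - s)) / 2" if st: "s \<in> T" "t \<in> T" "s \<le> t" for s t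
    proof -
      have ts: "t - s \<in> T"
        using st nonneg[OF st(1)] by (intro down[OF st(2)]) auto
      \<comment> \<open>The increment from \<open>s\<close> to \<open>t\<close> is shifted to start
        at 0, where the process vanishes.\<close>
      have "expectation (\<lambda>\<omega>. (X ((t - s) + s) \<omega> - X s \<omega>)\<^sup>2) =
          expectation (\<lambda>\<omega>. (X ((t - s) + 0) \<omega> - X 0 \<omega>)\<^sup>2)"
        using st ts zero_mem
        by (intro stationary[unfolded stationary_increments_def, rule_format]) auto
      also have "\<dots> = expectation (\<lambda>\<omega>. X (t - s) \<omega> * X (t - s) \<omega>)"
        using start ts zero_mem by (intro integral_cong_AE) (auto simp: power2_eq_square)
      finally show ?thesis
        using increment[OF st] var[OF ts] by simp
    qed
    interpret markov_variogram T r v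
    proof
      fix u s t assume *: "u \<in> T" "s \<in> T" "t \<in> T" "u \<le> s" "s \<le> t"
      then show "r u t = r u s / v s * r s t"
        using regression_if_markov_property[OF markov *] by (simp add: cov v_def)
    qed (fact zero_mem nonneg down up cov_eq v_zero v_nonneg)+
    obtain s0 t0 where st0: "s0 \<in> T" "t0 \<in> T"
      and indep: "\<And>a b. (AE \<omega> in M. a * X s0 \<omega> + b * X t0 \<omega> = 0) \<Longrightarrow> a = 0 \<and> b = 0"
      using nondegenerate unfolding nondegenerate_def by blast
    have X_nonzero: "v s0 \<noteq> 0"
    proof
      assume "v s0 = 0"
      then have "AE \<omega> in M. 1 * X s0 \<omega> + 0 * X t0 \<omega> = 0"
        using st0 by (intro lin_comb2_AE_zero) (simp_all add: var)
      from indep[OF this] show False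
        by simp
    qed
    interpret smooth_markov_variogram T r v
    proof
      fix t assume "t \<in> T" "0 < t"
      then show "0 < v t"
        using variance_vanishes[OF _ _ _ st0(1), of t] X_nonzero v_nonneg[of t] by (cases "v t = 0") auto
    qed (fact smooth)
    obtain \<theta> K where quadratic: "\<And>t. t \<in> T \<Longrightarrow> v t = \<theta> * t + K * t\<^sup>2"
      using variance_quadratic by blast
    \<comment> \<open>Inserting the quadratic into \<open>cov_eq\<close> leaves
      \<open>s * (\<theta> + K * t)\<close>, so \<open>- K\<close> serves as \<tau>.\<close>
    have r_eq: "r s t = s * (\<theta> - (- K) * t)" if st: "s \<in> T" "t \<in> T" "s \<le> t" for s t
    proof -
      have "t - s \<in> T"
        using st nonneg[OF st(1)] by (intro down[OF st(2)]) auto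
      then show ?thesis
        using cov_eq[OF st] st by (simp add: quadratic power2_eq_square field_simps)
    qed
    have slope: "(- K) * t < \<theta>" if t: "t \<in> T" "0 < t" for t
    proof -
      have "0 < t * (\<theta> + K * t)"
        using v_pos[OF t] quadratic[OF t(1)] by (simp add: power2_eq_square algebra_simps)
      then have "0 < \<theta> + K * t"
        using t by (simp add: zero_less_mult_iff)
      then show ?thesis
        by simp
    qed
    obtain t1 where t1: "t1 \<in> T" "0 < t1"
      using up[OF zero_mem] by blast
    \<comment> \<open>Positivity of \<open>\<theta> + K * t\<close> for small \<open>t\<close>
      survives in the limit only as a weak inequality; the value 0 is excluded afterwards by
      nondegeneracy.\<close>
    have "0 \<le> \<theta>"
    proof (rule tendsto_lowerbound)
      show "((\<lambda>t. \<theta> + K * t) \<longlongrightarrow> \<theta>) (at_right 0)"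
        by (auto intro!: tendsto_eq_intros)
      have "eventually (\<lambda>t. t \<in> {0<..<t1}) (at_right 0)"
        using t1 eventually_at_right_real by blast
      then show "eventually (\<lambda>t. 0 \<le> \<theta> + K * t) (at_right 0)"
      proof eventually_elim
        case (elim t)
        then show ?case
          using slope[of t] down[OF t1(1), of t] by simp
      qed
    qed simp
    moreover have "\<theta> \<noteq> 0"
    proof
      assume "\<theta> = 0"
      then have v0: "v t = K * t\<^sup>2" if "t \<in> T" for t
        using quadratic[OF that] by simp
      have "expectation (\<lambda>\<omega>. X s \<omega> * X t \<omega>) = K * s * t" if "s \<in> T" "t \<in> T" for s t
      proof (cases "s \<le> t")
        case True
        then show ?thesis
          using that r_eq[of s t] \<open>\<theta> = 0\<close> by (simp add: cov)
      next
        case False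
        then show ?thesis
          using that r_eq[of t s] cov[of t s] \<open>\<theta> = 0\<close> by (simp add: mult_ac)
      qed
      \<comment> \<open>For \<theta> = 0 the covariance \<open>K * s * t\<close> has rank one, and
        these weights annihilate it. Linear independence then forces \<open>s0 = 0\<close>, where
        the variance vanishes, against \<open>X_nonzero\<close>.\<close>
      then have "AE \<omega> in M. t0 * X s0 \<omega> + (- s0) * X t0 \<omega> = 0"
        using st0 by (intro lin_comb2_AE_zero) (simp_all add: power2_eq_square algebra_simps)
      from indep[OF this] have "s0 = 0"
        by simp
      then show False
        using X_nonzero v_zero by simp
    qed
    ultimately have \<theta>: "0 < \<theta>"
      by simp
    have "ereal (- K) \<le> ereal \<theta> / \<Delta>"
      unfolding ereal_le_divide_iff_bound[OF \<theta> assms(2)]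
    proof (intro allI impI)
      fix t assume "0 \<le> t \<and> ereal t < \<Delta>"
      then show "(- K) * t \<le> \<theta>"
        using slope[of t] \<theta> by (cases "t = 0") (auto simp: T)
    qed
    then show "\<exists>\<theta> \<tau>. 0 < \<theta> \<and> ereal \<tau> \<le> ereal \<theta> / \<Delta> \<and>
        (\<forall>s\<in>T. \<forall>t\<in>T. s \<le> t \<longrightarrow> r s t = s * (\<theta> - \<tau> * t))"
      using \<theta> r_eq by blast
  next

    \<comment> \<open>From the covariance to the two properties\<close>
    assume "\<exists>\<theta> \<tau>. 0 < \<theta> \<and> ereal \<tau> \<le> ereal \<theta> / \<Delta> \<and>
        (\<forall>s\<in>T. \<forall>t\<in>T. s \<le> t \<longrightarrow> r s t = s * (\<theta> - \<tau> * t))"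
    then obtain \<theta> \<tau> where \<theta>: "0 < \<theta>" and "ereal \<tau> \<le> ereal \<theta> / \<Delta>"
      and r_eq: "\<And>s t. s \<in> T \<Longrightarrow> t \<in> T \<Longrightarrow> s \<le> t \<Longrightarrow> r s t = s * (\<theta> - \<tau> * t)"
      by blast
    then have bound: "\<tau> * t \<le> \<theta>" if "t \<in> T" for t
      using that unfolding ereal_le_divide_iff_bound[OF \<theta> assms(2)] T by blast
    \<comment> \<open>For positive \<tau> the bound at a later time of \<open>T\<close> makes the
      bound at \<open>t\<close> strict. This keeps the denominator
      \<open>\<theta> - \<tau> * s\<close> of the regression coefficient away from 0.\<close>
    have strict: "\<tau> * t < \<theta>" if t: "t \<in> T" for t
    proof (cases "0 < \<tau>")
      case True
      obtain t' where "t' \<in> T" "t < t'"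
        using up[OF t] by blast
      then show ?thesis
        using bound[of t'] mult_strict_left_mono[OF \<open>t < t'\<close> True] by simp
    next
      case False
      then show ?thesis
        using \<theta> nonneg[OF t] mult_nonpos_nonneg[of \<tau> t] by simp
    qed
    have increment_eq: "expectation (\<lambda>\<omega>. (X (t + s) \<omega> - X s \<omega>)\<^sup>2) = \<theta> * t - \<tau> * t\<^sup>2"
      if "0 \<le> t" "s \<in> T" "t + s \<in> T" for s t
      using that increment[of s "t + s"] by (simp add: v_def r_eq power2_eq_square algebra_simps)
    have "stationary_increments M T X"
      unfolding stationary_increments_def
    proof (intro allI impI, elim conjE)
      fix t s s' :: real
      assume "0 \<le> t" "s \<in> T" "s + t \<in> T" "s' \<in> T" "s' + t \<in> T"
      then show "expectation (\<lambda>\<omega>. (X (t + s) \<omega> - X s \<omega>)\<^sup>2) = expectation (\<lambda>\<omega>. (X (t + s') \<omega> - X s' \<omega>)\<^sup>2)"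
        using increment_eq[of t s] increment_eq[of t s'] by (simp add: add.commute)
    qed
    moreover have "markov_property M T X"
    proof (rule markov_property_if_regression)
      fix s t assume st: "s \<in> T" "t \<in> T" "s \<le> t"
      \<comment> \<open>The coefficient is the ratio of \<open>r u t\<close> to
        \<open>r u s\<close>, in which \<open>u\<close> cancels.\<close>
      have "expectation (\<lambda>\<omega>. X u \<omega> * X t \<omega>) =
          (\<theta> - \<tau> * t) / (\<theta> - \<tau> * s) * expectation (\<lambda>\<omega>. X u \<omega> * X s \<omega>)" if "u \<in> T" "u \<le> s" for u
        using that st strict[OF st(1)] by (simp add: cov r_eq)
      then show "\<exists>c. \<forall>u\<in>T. u \<le> s \<longrightarrow>
          expectation (\<lambda>\<omega>. X u \<omega> * X t \<omega>) = c * expectation (\<lambda>\<omega>. X u \<omega> * X s \<omega>)"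
        by blast
    qed
    ultimately show "stationary_increments M T X \<and> markov_property M T X" ..
  qed
qed

end
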